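(* As $n\to\infty$, $$n^{-1/2}\bigl(X_n^{(1)*}-\tfrac4{27}n\bigr)\overset{\mathrm d}{\longrightarrow}N\bigl(0,\tfrac{76}{729}\bigr),$$ with convergence of all moments. In particular, $$\mathbb E X_n^{(1)*}=\tfrac4{27}n+o(n^{1/2}),\qquad\operatorname{Var}X_n^{(1)*}=\tfrac{76}{729}n+o(n).$$
   Context: For $n\ge 2$ let $\sigma$ be a uniformly random permutation of $\{1,\dots,n\}$. For $0\le m\le n$ and $1\le k\le n$ let $I_{n,m}(k)=1$ if $\sigma^{-1}(k)\le m$ and $I_{n,m}(k)=0$ otherwise, with indices $k$ interpreted modulo $n$ (cyclic convention, $I_{n,m}(k+n)=I_{n,m}(k)$). The number of runs of ones of length exactly $1$ after $m$ steps is $$X_{n,m}^{(1)}=\sum_{k=1}^n\bigl(1-I_{n,m}(k)\bigr)I_{n,m}(k+1)\bigl(1-I_{n,m}(k+2)\bigr),$$ and $X_n^{(1)*}=\max_{0\le m\le n}X_{n,m}^{(1)}$. $\overset{\mathrm d}{\longrightarrow}$ denotes convergence in distribution, and "convergence of all moments" means that all moments of the left-hand side converge to the corresponding moments of the limit. *)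

theory Defs
  imports "HOL-Probability.Probability" "HOL-Combinatorics.Permutations"
    "HOL-Library.Landau_Symbols"
begin

definition random_perm :: "nat \<Rightarrow> (nat \<Rightarrow> nat) pmf" where
  "random_perm n = pmf_of_set {\<sigma>. \<sigma> permutes {1..n}}"

text \<open>The representative of \<open>k\<close> modulo \<open>n\<close> in \<open>{1..n}\<close>, for \<open>n \<ge> 1\<close>.\<close>

definition cyc :: "nat \<Rightarrow> nat \<Rightarrow> nat" where
  "cyc n k = (if n dvd k then n else k mod n)"

definition I_ind :: "nat \<Rightarrow> nat \<Rightarrow> (nat \<Rightarrow> nat) \<Rightarrow> nat \<Rightarrow> real" where
  "I_ind n m \<sigma> k = (if inv \<sigma> (cyc n k) \<le> m then 1 else 0)"

definition X1 :: "nat \<Rightarrow> nat \<Rightarrow> (nat \<Rightarrow> nat) \<Rightarrow> real" where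
  "X1 n m \<sigma> =
     (\<Sum>k = 1..n. (1 - I_ind n m \<sigma> k) * I_ind n m \<sigma> (k + 1) * (1 - I_ind n m \<sigma> (k + 2)))"

definition X1_max :: "nat \<Rightarrow> (nat \<Rightarrow> nat) \<Rightarrow> real" where
  "X1_max n \<sigma> = Max ((\<lambda>m. X1 n m \<sigma>) ` {0..n})"

definition Z1 :: "nat \<Rightarrow> (nat \<Rightarrow> nat) \<Rightarrow> real" where
  "Z1 n \<sigma> = real n powr (-1/2) * (X1_max n \<sigma> - 4/27 * real n)"

text \<open>The normal law with variance (not standard deviation) \<open>v > 0\<close>;
  \<^const>\<open>normal_density\<close> is parametrised by the standard deviation.\<close>

definition normal_law :: "real \<Rightarrow> real \<Rightarrow> real measure" where
  "normal_law \<mu> v = density lborel (normal_density \<mu> (sqrt v))"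

end

theory Submission
  imports Defs "HOL-Real_Asymp.Real_Asymp"
begin

text \<open>
  Write \<open>g p = p * (1 - p)\<^sup>2\<close>, which has its maximum \<open>4/27\<close> on \<open>{0..1}\<close> at \<open>p = 1/3\<close>.
  Colour the positions independently by a coin of bias \<open>p\<close>. The number of isolated ones is then a
  sum of \<open>n\<close> locally dependent bounded terms with mean \<open>n * g p\<close>, and for \<open>p = 1/3\<close> its variance is
  \<open>76/729 * n\<close>. Tikhomirov's differential equation for the characteristic function gives
  the central limit theorem, and splitting the terms into six independent classes gives Bernstein type
  exponential moments.

  Conditioned on its number \<open>N\<close> of ones, the colouring has the law of the configuration of the random
  permutation after \<open>N\<close> steps. Hence the iid count is \<open>X1 n N\<close> for a random time \<open>N\<close> with
  \<open>N - n/3\<close> of order \<open>\<surd>n\<close>, and since \<open>g'\<close> vanishes at \<open>1/3\<close> it remains to see that the maximum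
  over all times exceeds \<open>X1 n N\<close> by \<open>o(\<surd>n)\<close> only. For this, exponential moments of the increments
  \<open>X1 n m' - X1 n m\<close> are transferred from an iid colouring with three colours, at the cost of
  a factor polynomial in \<open>n\<close>, the inverse probability that the colour counts take their typical
  values. They show that with overwhelming probability all increments deviate from their means by at
  most \<open>n powr (1/16)\<close> times \<open>\<surd>(m' - m)\<close>, which the quadratic decay of \<open>g\<close> around \<open>1/3\<close> beats.
\<close>

subsection \<open>Independence and exponential moments in finite product spaces\<close>

text \<open>To leading order the variance of the iid count is that at a fixed time plus
  \<open>(g' p)\<^sup>2 * p * (1 - p) * n\<close> from the random \<open>N\<close>. At the maximiser
  the second part vanishes, so the iid variance is already the one of the theorem. An increment
  between two times sees each position as early, intermediate or late, hence three colours.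
  Conditioning on the three exact counts costs \<open>(n + 1) ^ 3\<close>, one factor per factorial,
  and the union over all pairs of times another \<open>(n + 1) ^ 2\<close>. With
  \<open>\<beta> = n powr (1/16)\<close> any such power is absorbed by
  \<open>exp (- \<beta> / 12)\<close>, so crude constants suffice throughout. As all counts lie
  between \<open>0\<close> and \<open>n\<close>, the exceptional event is negligible for every
  moment of the difference as well. The exponent \<open>1/16\<close> turns all scales into integral
  powers of \<open>\<beta>\<close>: \<open>\<surd>n\<close> is \<open>\<beta> ^ 8\<close>, the
  allowed deviation of \<open>N\<close> is \<open>\<beta> ^ 9\<close>, the critical distance from
  \<open>n / 3\<close> is \<open>\<beta> ^ 12\<close>, and the loss is at most
  \<open>3 * \<beta> ^ 7\<close>.\<close>

definition depends_on :: "(('i \<Rightarrow> 'a) \<Rightarrow> 'b) \<Rightarrow> 'i set \<Rightarrow> bool" where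
  "depends_on f A \<longleftrightarrow> (\<forall>x y. (\<forall>i\<in>A. x i = y i) \<longrightarrow> f x = f y)"

lemma depends_onD: "depends_on f A \<Longrightarrow> (\<And>i. i \<in> A \<Longrightarrow> x i = y i) \<Longrightarrow> f x = f y"
  unfolding depends_on_def by blast

lemma depends_on_mono: "depends_on f A \<Longrightarrow> A \<subseteq> B \<Longrightarrow> depends_on f B"
  unfolding depends_on_def by blast

lemma depends_on_comp: "depends_on f A \<Longrightarrow> depends_on (\<lambda>x. h (f x)) A"
  unfolding depends_on_def by metis

lemma depends_on_comp2:
  "depends_on f A \<Longrightarrow> depends_on g A \<Longrightarrow> depends_on (\<lambda>x. h (f x) (g x)) A"
  unfolding depends_on_def by metis

lemma depends_on_sum:
  assumes "\<And>k. k \<in> K \<Longrightarrow> depends_on (f k) A"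
  shows "depends_on (\<lambda>x. \<Sum>k\<in>K. f k x) A"
  unfolding depends_on_def by (auto intro!: sum.cong depends_onD[OF assms])

lemma depends_on_prod:
  assumes "\<And>k. k \<in> K \<Longrightarrow> depends_on (f k) A"
  shows "depends_on (\<lambda>x. \<Prod>k\<in>K. f k x) A"
  unfolding depends_on_def by (auto intro!: prod.cong depends_onD[OF assms])

lemma finite_set_Pi_pmf:
  assumes "finite I" "\<And>i. i \<in> I \<Longrightarrow> finite (set_pmf (p i))"
  shows "finite (set_pmf (Pi_pmf I d p))"
  using assms by (auto simp: set_Pi_pmf intro!: finite_PiE_dflt)

lemma expectation_pair_pmf_finite:
  fixes h :: "'a \<times> 'b \<Rightarrow> 'c::{banach, second_countable_topology}"
  assumes "finite (set_pmf p)" "finite (set_pmf q)"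
  shows "measure_pmf.expectation (pair_pmf p q) h
         = measure_pmf.expectation p (\<lambda>x. measure_pmf.expectation q (\<lambda>y. h (x, y)))"
proof -
  have "measure_pmf.expectation (pair_pmf p q) h = (\<Sum>a\<in>set_pmf p. pmf p a *\<^sub>R
          measure_pmf.expectation (bind_pmf q (\<lambda>y. return_pmf (a, y))) h)"
    unfolding pair_pmf_def using assms by (subst pmf_expectation_bind[of "set_pmf p"]) auto
  also have "\<dots> = (\<Sum>a\<in>set_pmf p. pmf p a *\<^sub>R measure_pmf.expectation q (\<lambda>y. h (a, y)))"
    by (simp flip: map_pmf_def)
  also have "\<dots> = measure_pmf.expectation p (\<lambda>x. measure_pmf.expectation q (\<lambda>y. h (x, y)))"
    using assms by (subst integral_measure_pmf[of "set_pmf p"]) auto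
  finally show ?thesis .
qed

text \<open>The product measure is that of the coordinates in \<open>A\<close> paired with that of
  the others; \<open>f\<close> sees only the first component and \<open>g\<close> only the second.
  The values lie in a normed field so that one lemma serves real exponential moments and complex
  characteristic functions.\<close>

lemma expectation_Pi_pmf_mult_indep:
  fixes f g :: "('i \<Rightarrow> 'a) \<Rightarrow> 'b::{real_normed_field, banach, second_countable_topology}"
  assumes I: "finite I" and p: "\<And>i. i \<in> I \<Longrightarrow> finite (set_pmf (p i))"
    and f: "depends_on f A" and g: "depends_on g B" and A: "A \<subseteq> I" and AB: "A \<inter> B = {}"
  shows "measure_pmf.expectation (Pi_pmf I d p) (\<lambda>x. f x * g x)
         = measure_pmf.expectation (Pi_pmf I d p) f * measure_pmf.expectation (Pi_pmf I d p) g"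
proof -
  let ?P = "Pi_pmf A d p" and ?Q = "Pi_pmf (I - A) d p"
  let ?m = "\<lambda>(x, y) i. if i \<in> A then x i else y i"
  have fin: "finite A" "finite (I - A)" using I A by (auto intro: finite_subset)
  have fP: "finite (set_pmf ?P)" "finite (set_pmf ?Q)"
    using fin A p by (auto intro!: finite_set_Pi_pmf)
  have un: "A \<union> (I - A) = I" using A by auto
  have eq: "Pi_pmf I d p = map_pmf ?m (pair_pmf ?P ?Q)"
    using Pi_pmf_union[OF fin, of d p] un by simp
  have fm: "f (?m (x, y)) = f x" for x y by (rule depends_onD[OF f]) auto
  have gm: "g (?m (x, y)) = g y" for x y by (rule depends_onD[OF g]) (use AB in auto)
  have E: "measure_pmf.expectation (Pi_pmf I d p) h
      = measure_pmf.expectation ?P (\<lambda>x. measure_pmf.expectation ?Q (\<lambda>y. h (?m (x, y))))"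
    for h :: "('i \<Rightarrow> 'a) \<Rightarrow> 'b"
    unfolding eq integral_map_pmf by (subst expectation_pair_pmf_finite[OF fP]) simp
  show ?thesis unfolding E fm gm by simp
qed

lemma expectation_Pi_pmf_prod_indep:
  fixes f :: "'k \<Rightarrow> ('i \<Rightarrow> 'a) \<Rightarrow> 'b::{real_normed_field, banach, second_countable_topology}"
  assumes I: "finite I" and p: "\<And>i. i \<in> I \<Longrightarrow> finite (set_pmf (p i))"
    and K: "finite K" and f: "\<And>k. k \<in> K \<Longrightarrow> depends_on (f k) (D k)"
    and D: "\<And>k. k \<in> K \<Longrightarrow> D k \<subseteq> I"
    and disj: "\<And>j k. j \<in> K \<Longrightarrow> k \<in> K \<Longrightarrow> j \<noteq> k \<Longrightarrow> D j \<inter> D k = {}"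
  shows "measure_pmf.expectation (Pi_pmf I d p) (\<lambda>x. \<Prod>k\<in>K. f k x)
         = (\<Prod>k\<in>K. measure_pmf.expectation (Pi_pmf I d p) (f k))"
  using K f D disj
proof (induction K rule: finite_induct)
  case empty
  then show ?case by simp
next
  case (insert k K)
  have dep: "depends_on (\<lambda>x. \<Prod>j\<in>K. f j x) (\<Union>j\<in>K. D j)"
    by (intro depends_on_prod depends_on_mono[OF insert.prems(1)]) auto
  have "measure_pmf.expectation (Pi_pmf I d p) (\<lambda>x. f k x * (\<Prod>j\<in>K. f j x))
     = measure_pmf.expectation (Pi_pmf I d p) (f k) *
       measure_pmf.expectation (Pi_pmf I d p) (\<lambda>x. \<Prod>j\<in>K. f j x)"
    by (rule expectation_Pi_pmf_mult_indep[OF I p insert.prems(1) dep])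
       (use insert in \<open>auto, blast\<close>)
  then show ?case using insert by simp
qed

section \<open>Bernstein type exponential moments of locally dependent sums\<close>

lemma exp_le_quadratic:
  fixes x :: real assumes "\<bar>x\<bar> \<le> 1" shows "exp x \<le> 1 + x + x\<^sup>2"
proof (cases "x \<ge> 0")
  case True
  then show ?thesis using assms exp_bound[of x] by simp
next
  case False
  define y where "y = - x"
  have y: "0 \<le> y" using False by (simp add: y_def)
  \<comment> \<open>For negative \<open>x\<close> the claim is multiplied by \<open>exp y\<close>,
    and \<open>exp y\<close> is bounded below by its quadratic Taylor polynomial; in the product the
    linear terms cancel and the rest is nonnegative.\<close>
  have "1 \<le> (1 - y + y\<^sup>2) * (1 + y + y\<^sup>2 / 2)"
  proof -
    have "(1 - y + y\<^sup>2) * (1 + y + y\<^sup>2 / 2) = 1 + (y^2 + y^3 + y^4) / 2"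
      by (simp add: power2_eq_square power3_eq_cube power4_eq_xxxx field_simps)
    then show ?thesis using y by simp
  qed
  also have "\<dots> \<le> (1 - y + y\<^sup>2) * exp y"
  proof (rule mult_left_mono)
    show "1 + y + y\<^sup>2 / 2 \<le> exp y" using exp_lower_Taylor_quadratic[OF y] by simp
    have "0 \<le> (1 - y)\<^sup>2 + y" using y by simp
    also have "\<dots> = 1 - y + y\<^sup>2" by (simp add: power2_eq_square algebra_simps)
    finally show "0 \<le> 1 - y + y\<^sup>2" .
  qed
  finally have "exp (- y) \<le> 1 - y + y\<^sup>2"
    by (simp add: exp_minus field_simps)
  then show ?thesis by (simp add: y_def)
qed

text \<open>Since \<open>\<theta> * (h - \<mu>)\<close> has modulus at most 1, the exponential may
  be replaced by a quadratic, whose linear term vanishes in the mean. The bound keeps the second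
  moment \<open>v\<close>, which is far below 1 for the increments between close times.\<close>

lemma exp_moment_bounded:
  fixes h :: "'a \<Rightarrow> real"
  assumes fin: "finite (set_pmf M)" and h: "\<And>x. \<bar>h x\<bar> \<le> 1"
    and v: "measure_pmf.expectation M (\<lambda>x. (h x)\<^sup>2) \<le> v" and th: "\<bar>\<theta>\<bar> \<le> 1/2"
  shows "measure_pmf.expectation M (\<lambda>x. exp (\<theta> * (h x - measure_pmf.expectation M h)))
         \<le> exp (\<theta>\<^sup>2 * v)"
proof -
  note int [simp] = integrable_measure_pmf_finite[OF fin]
  define \<mu> where "\<mu> = measure_pmf.expectation M h"
  have mu: "\<bar>\<mu>\<bar> \<le> 1"
  proof -
    have "\<bar>\<mu>\<bar> \<le> measure_pmf.expectation M (\<lambda>x. \<bar>h x\<bar>)" unfolding \<mu>_def by simp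
    also have "\<dots> \<le> measure_pmf.expectation M (\<lambda>x. 1)" by (intro integral_mono) (auto simp: h)
    finally show ?thesis by simp
  qed
  have "measure_pmf.expectation M (\<lambda>x. exp (\<theta> * (h x - \<mu>)))
     \<le> measure_pmf.expectation M (\<lambda>x. 1 + \<theta> * (h x - \<mu>) + \<theta>\<^sup>2 * (h x - \<mu>)\<^sup>2)"
  proof (intro integral_mono)
    fix x
    have "\<bar>h x - \<mu>\<bar> \<le> 2" using h[of x] mu by linarith
    then have "\<bar>\<theta>\<bar> * \<bar>h x - \<mu>\<bar> \<le> (1/2) * 2" using th by (intro mult_mono) auto
    then have "\<bar>\<theta> * (h x - \<mu>)\<bar> \<le> 1" by (simp add: abs_mult)
    from exp_le_quadratic[OF this]
    show "exp (\<theta> * (h x - \<mu>)) \<le> 1 + \<theta> * (h x - \<mu>) + \<theta>\<^sup>2 * (h x - \<mu>)\<^sup>2"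
      by (simp add: power_mult_distrib)
  qed auto
  also have "\<dots> = measure_pmf.expectation M (\<lambda>x. (1 - \<theta> * \<mu> + \<theta>\<^sup>2 * \<mu>\<^sup>2)
       + (\<theta> - 2 * \<theta>\<^sup>2 * \<mu>) * h x + \<theta>\<^sup>2 * (h x)\<^sup>2)"
    by (rule Bochner_Integration.integral_cong) (auto simp: power2_eq_square algebra_simps)
  also have "\<dots> = (1 - \<theta> * \<mu> + \<theta>\<^sup>2 * \<mu>\<^sup>2) + (\<theta> - 2 * \<theta>\<^sup>2 * \<mu>) * \<mu>
      + \<theta>\<^sup>2 * measure_pmf.expectation M (\<lambda>x. (h x)\<^sup>2)"
    by (simp add: \<mu>_def)
  also have "\<dots> = 1 + \<theta>\<^sup>2 * (measure_pmf.expectation M (\<lambda>x. (h x)\<^sup>2) - \<mu>\<^sup>2)"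
    by (simp add: algebra_simps power2_eq_square)
  also have "\<dots> \<le> 1 + \<theta>\<^sup>2 * v"
    using v by (intro add_left_mono mult_left_mono) (auto intro: order_trans[OF _ v])
  also have "\<dots> \<le> exp (\<theta>\<^sup>2 * v)" by simp
  finally show ?thesis by (simp add: \<mu>_def)
qed

text \<open>Jensen's inequality for the mean of the numbers \<open>q * x i\<close>. It merges
  classes that depend on each other, at the price of a factor \<open>q\<close> in the
  exponent.\<close>

lemma exp_sum_le_mean:
  fixes x :: "nat \<Rightarrow> real"
  assumes "q > 0"
  shows "exp (\<Sum>i<q. x i) \<le> (\<Sum>i<q. exp (real q * x i)) / real q"
proof -
  have "exp (\<Sum>i\<in>{..<q}. (1 / real q) *\<^sub>R (real q * x i)) \<le> (\<Sum>i\<in>{..<q}. (1 / real q) * exp (real q * x i))"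
    by (rule convex_on_sum[OF _ _ exp_convex]) (use assms in auto)
  then show ?thesis using assms by (simp add: sum_divide_distrib)
qed

text \<open>\<open>\<kappa>\<close> colours the summands so that those of one colour read disjoint
  sets of coordinates and are independent. Within a colour the exponential moment factorises; across
  the colours Jensen's inequality replaces \<open>\<theta>\<close> by
  \<open>q * \<theta>\<close>.\<close>

lemma exp_moment_local_sum:
  fixes h :: "'k \<Rightarrow> ('i \<Rightarrow> 'a) \<Rightarrow> real" and \<kappa> :: "'k \<Rightarrow> nat"
  assumes I: "finite I" and p: "\<And>i. i \<in> I \<Longrightarrow> finite (set_pmf (p i))"
    and K: "finite K" and dep: "\<And>k. k \<in> K \<Longrightarrow> depends_on (h k) (D k)"
    and D: "\<And>k. k \<in> K \<Longrightarrow> D k \<subseteq> I"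
    and \<kappa>: "\<And>k. k \<in> K \<Longrightarrow> \<kappa> k < q"
    and disj: "\<And>j k. j \<in> K \<Longrightarrow> k \<in> K \<Longrightarrow> j \<noteq> k \<Longrightarrow> \<kappa> j = \<kappa> k \<Longrightarrow> D j \<inter> D k = {}"
    and h: "\<And>k x. k \<in> K \<Longrightarrow> \<bar>h k x\<bar> \<le> 1"
    and v: "\<And>k. k \<in> K \<Longrightarrow> measure_pmf.expectation (Pi_pmf I d p) (\<lambda>x. (h k x)\<^sup>2) \<le> v"
    and v0: "0 \<le> v" and q: "q > 0" and th: "real q * \<bar>\<theta>\<bar> \<le> 1/2"
  shows "measure_pmf.expectation (Pi_pmf I d p)
           (\<lambda>x. exp (\<theta> * (\<Sum>k\<in>K. h k x - measure_pmf.expectation (Pi_pmf I d p) (h k))))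
         \<le> exp ((real q * \<theta>)\<^sup>2 * (real (card K) * v))"
proof -
  define P where "P = Pi_pmf I d p"
  have fin: "finite (set_pmf P)" unfolding P_def by (rule finite_set_Pi_pmf[OF I p])
  note int [simp] = integrable_measure_pmf_finite[OF fin]
  define c where "c k x = h k x - measure_pmf.expectation P (h k)" for k x
  define C where "C i = {k \<in> K. \<kappa> k = i}" for i
  have C: "finite (C i)" "C i \<subseteq> K" for i using K by (auto simp: C_def)
  have cls: "measure_pmf.expectation P (\<lambda>x. exp (real q * (\<theta> * (\<Sum>k\<in>C i. c k x))))
      \<le> exp ((real q * \<theta>)\<^sup>2 * (real (card K) * v))" for i
  proof -
    have "measure_pmf.expectation P (\<lambda>x. exp (real q * (\<theta> * (\<Sum>k\<in>C i. c k x))))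
       = measure_pmf.expectation P (\<lambda>x. \<Prod>k\<in>C i. exp (real q * \<theta> * c k x))"
      by (simp add: exp_sum[OF C(1), symmetric] sum_distrib_left mult.assoc)
    also have "\<dots> = (\<Prod>k\<in>C i. measure_pmf.expectation P (\<lambda>x. exp (real q * \<theta> * c k x)))"
      unfolding P_def
    proof (rule expectation_Pi_pmf_prod_indep[where D = D, OF I p C(1)])
      fix k assume "k \<in> C i"
      then have "k \<in> K" using C by auto
      from dep[OF this] show "depends_on (\<lambda>x. exp (real q * \<theta> * c k x)) (D k)"
        unfolding c_def by (rule depends_on_comp)
      show "D k \<subseteq> I" using \<open>k \<in> K\<close> D by auto
    next
      fix j k assume "j \<in> C i" "k \<in> C i" "j \<noteq> k"
      then show "D j \<inter> D k = {}" by (intro disj) (auto simp: C_def)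
    qed
    also have "\<dots> \<le> (\<Prod>k\<in>C i. exp ((real q * \<theta>)\<^sup>2 * v))"
    proof (rule prod_mono, safe)
      fix k assume "k \<in> C i"
      then have k: "k \<in> K" using C by auto
      show "measure_pmf.expectation P (\<lambda>x. exp (real q * \<theta> * c k x)) \<le> exp ((real q * \<theta>)\<^sup>2 * v)"
        unfolding c_def
        by (rule exp_moment_bounded[OF fin h[OF k]]) (use v[OF k] th in \<open>auto simp: P_def abs_mult\<close>)
    qed (auto intro!: integral_nonneg)
    also have "\<dots> = exp ((real q * \<theta>)\<^sup>2 * (real (card (C i)) * v))"
      by (simp add: exp_of_nat_mult[symmetric] mult_ac)
    also have "\<dots> \<le> exp ((real q * \<theta>)\<^sup>2 * (real (card K) * v))"
      using card_mono[OF K C(2)] v0 by (auto intro!: mult_left_mono mult_right_mono)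
    finally show ?thesis .
  qed
  have split: "(\<Sum>k\<in>K. c k x) = (\<Sum>i<q. \<Sum>k\<in>C i. c k x)" for x
    unfolding C_def by (rule sum.group[symmetric]) (use K \<kappa> in auto)
  have "measure_pmf.expectation P (\<lambda>x. exp (\<theta> * (\<Sum>k\<in>K. c k x)))
     \<le> measure_pmf.expectation P (\<lambda>x. (\<Sum>i<q. exp (real q * (\<theta> * (\<Sum>k\<in>C i. c k x)))) / real q)"
    unfolding split
    by (intro integral_mono int) (use exp_sum_le_mean[OF q] in \<open>simp only: sum_distrib_left[of \<theta>]\<close>)
  also have "\<dots> = (\<Sum>i<q. measure_pmf.expectation P (\<lambda>x. exp (real q * (\<theta> * (\<Sum>k\<in>C i. c k x))))) / real q"
    by simp
  also have "\<dots> \<le> (\<Sum>i<q. exp ((real q * \<theta>)\<^sup>2 * (real (card K) * v))) / real q"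
    by (intro divide_right_mono sum_mono cls) auto
  also have "\<dots> = exp ((real q * \<theta>)\<^sup>2 * (real (card K) * v))" using q by simp
  finally show ?thesis unfolding P_def c_def .
qed

text \<open>With \<open>\<theta> = 1 / (2 * q * s)\<close> the exponent of the previous bound is at
  most \<open>1/4\<close>, and \<open>exp (1/4) \<le> 3/2\<close>. The two signs of the sum together
  give 3. The condition \<open>1 \<le> s\<close> makes \<open>\<theta>\<close> admissible.\<close>

lemma exp_abs_moment_local_sum:
  fixes h :: "'k \<Rightarrow> ('i \<Rightarrow> 'a) \<Rightarrow> real" and \<kappa> :: "'k \<Rightarrow> nat"
  assumes I: "finite I" and p: "\<And>i. i \<in> I \<Longrightarrow> finite (set_pmf (p i))"
    and K: "finite K" and dep: "\<And>k. k \<in> K \<Longrightarrow> depends_on (h k) (D k)"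
    and D: "\<And>k. k \<in> K \<Longrightarrow> D k \<subseteq> I"
    and \<kappa>: "\<And>k. k \<in> K \<Longrightarrow> \<kappa> k < q"
    and disj: "\<And>j k. j \<in> K \<Longrightarrow> k \<in> K \<Longrightarrow> j \<noteq> k \<Longrightarrow> \<kappa> j = \<kappa> k \<Longrightarrow> D j \<inter> D k = {}"
    and h: "\<And>k x. k \<in> K \<Longrightarrow> \<bar>h k x\<bar> \<le> 1"
    and v: "\<And>k. k \<in> K \<Longrightarrow> measure_pmf.expectation (Pi_pmf I d p) (\<lambda>x. (h k x)\<^sup>2) \<le> v"
    and v0: "0 \<le> v" and q: "q > 0" and s: "real (card K) * v \<le> s\<^sup>2" "1 \<le> s"
  shows "measure_pmf.expectation (Pi_pmf I d p)
           (\<lambda>x. exp (\<bar>\<Sum>k\<in>K. h k x - measure_pmf.expectation (Pi_pmf I d p) (h k)\<bar> / (2 * real q * s)))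
         \<le> 3"
proof -
  define P where "P = Pi_pmf I d p"
  have fin: "finite (set_pmf P)" unfolding P_def by (rule finite_set_Pi_pmf[OF I p])
  note int [simp] = integrable_measure_pmf_finite[OF fin]
  define T where "T x = (\<Sum>k\<in>K. h k x - measure_pmf.expectation P (h k))" for x
  define \<theta> where "\<theta> = 1 / (2 * real q * s)"
  have th: "real q * \<theta> = 1 / (2 * s)" using q s by (simp add: \<theta>_def)
  have th0: "\<theta> \<ge> 0" using q s by (simp add: \<theta>_def)
  have le: "(real q * \<theta>)\<^sup>2 * (real (card K) * v) \<le> 1/4"
  proof -
    have "(real q * \<theta>)\<^sup>2 * (real (card K) * v) \<le> (real q * \<theta>)\<^sup>2 * s\<^sup>2"
      by (intro mult_left_mono s) auto
    also have "\<dots> = 1/4" using s by (simp add: th power_divide power_mult_distrib)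
    finally show ?thesis .
  qed
  have B: "measure_pmf.expectation P (\<lambda>x. exp (t * T x)) \<le> 3/2" if "t = \<theta> \<or> t = -\<theta>" for t
  proof -
    have "real q * \<bar>t\<bar> = 1 / (2 * s)" using that th th0 by auto
    also have "\<dots> \<le> 1/2" using s by (simp add: field_simps)
    finally have "measure_pmf.expectation P (\<lambda>x. exp (t * T x)) \<le> exp ((real q * t)\<^sup>2 * (real (card K) * v))"
      unfolding P_def T_def by (intro exp_moment_local_sum[OF I p K dep D \<kappa> disj h v v0 q]) auto
    also have "\<dots> \<le> exp (1/4)" using le that by auto
    also have "\<dots> \<le> 3/2" using exp_le_quadratic[of "1/4"] by (simp add: power2_eq_square)
    finally show ?thesis .
  qed
  have "measure_pmf.expectation P (\<lambda>x. exp (\<bar>T x\<bar> / (2 * real q * s)))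
     \<le> measure_pmf.expectation P (\<lambda>x. exp (\<theta> * T x) + exp (- \<theta> * T x))"
  proof (intro integral_mono int)
    fix x
    have "\<bar>T x\<bar> / (2 * real q * s) = \<theta> * T x \<or> \<bar>T x\<bar> / (2 * real q * s) = - \<theta> * T x"
      by (auto simp: \<theta>_def abs_if)
    then show "exp (\<bar>T x\<bar> / (2 * real q * s)) \<le> exp (\<theta> * T x) + exp (- \<theta> * T x)"
      by (auto simp: add_increasing add_increasing2)
  qed
  also have "\<dots> = measure_pmf.expectation P (\<lambda>x. exp (\<theta> * T x))
      + measure_pmf.expectation P (\<lambda>x. exp (- \<theta> * T x))"
    by simp
  also have "\<dots> \<le> 3" using B[of \<theta>] B[of "-\<theta>"] by simp
  finally show ?thesis unfolding P_def T_def .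
qed

subsection \<open>Characteristic functions under local dependence\<close>

lemma norm_iexp_diff_le: "norm (iexp x - iexp y) \<le> \<bar>x - y\<bar>"
proof -
  have "iexp x - iexp y = iexp y * (iexp (x - y) - 1)"
    by (simp add: algebra_simps flip: exp_add)
  then have "norm (iexp x - iexp y) = norm (iexp (x - y) - 1)"
    by (simp add: norm_mult)
  also have "\<dots> \<le> \<bar>x - y\<bar>" using iexp_approx1[of "x - y" 0] by simp
  finally show ?thesis .
qed

lemma norm_expectation_le:
  fixes f :: "'a \<Rightarrow> 'b::{banach, second_countable_topology}"
  assumes "finite (set_pmf M)" "\<And>x. norm (f x) \<le> c"
  shows "norm (measure_pmf.expectation M f) \<le> c"
proof -
  have "norm (measure_pmf.expectation M f) \<le> measure_pmf.expectation M (\<lambda>x. norm (f x))"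
    by simp
  also have "\<dots> \<le> measure_pmf.expectation M (\<lambda>x. c)"
    by (intro integral_mono integrable_measure_pmf_finite assms)
  finally show ?thesis by simp
qed

text \<open>Replacing the sum by its part that is independent of \<open>X k\<close>, and then by the part that
  is independent of the whole neighbourhood of \<open>k\<close>, costs only third-order terms.\<close>

lemma local_dependence_step:
  fixes X :: "'k \<Rightarrow> ('i \<Rightarrow> 'a) \<Rightarrow> real" and D :: "'k \<Rightarrow> 'i set"
  defines "N \<equiv> \<lambda>K k. {j\<in>K. D j \<inter> D k \<noteq> {}}"
  assumes I: "finite I" and p: "\<And>i. i \<in> I \<Longrightarrow> finite (set_pmf (p i))"
    and K: "finite K" and dep: "\<And>k. k \<in> K \<Longrightarrow> depends_on (X k) (D k)"
    and D: "\<And>k. k \<in> K \<Longrightarrow> D k \<subseteq> I"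
    and X: "\<And>k x. k \<in> K \<Longrightarrow> \<bar>X k x\<bar> \<le> B"
    and mean: "measure_pmf.expectation (Pi_pmf I d p) (X k) = 0"
    and r1: "card (N K k) \<le> r1"
    and r2: "card {j\<in>K. D j \<inter> (D k \<union> (\<Union>i\<in>N K k. D i)) \<noteq> {}} \<le> r2"
    and k: "k \<in> K"
  shows "norm (measure_pmf.expectation (Pi_pmf I d p) (\<lambda>x. X k x * iexp (s * (\<Sum>j\<in>K. X j x)))
      - \<i> * s * (\<Sum>j\<in>N K k. measure_pmf.expectation (Pi_pmf I d p) (\<lambda>x. X k x * X j x))
        * measure_pmf.expectation (Pi_pmf I d p) (\<lambda>x. iexp (s * (\<Sum>j\<in>K. X j x))))
    \<le> (real r1 ^ 2 / 2 + 2 * real r1 * real r2) * B ^ 3 * s\<^sup>2"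
proof -
  define P where "P = Pi_pmf I d p"
  have fin: "finite (set_pmf P)" unfolding P_def by (rule finite_set_Pi_pmf[OF I p])
  note intR = integrable_measure_pmf_finite[OF fin, where 'b = real]
  note intC = integrable_measure_pmf_finite[OF fin, where 'b = complex]
  define N1 where "N1 = N K k"
  define U where "U = D k \<union> (\<Union>i\<in>N1. D i)"
  define N2 where "N2 = {j\<in>K. D j \<inter> U \<noteq> {}}"
  have N1: "N1 \<subseteq> N2" "N2 \<subseteq> K" "finite N1" "finite N2" "card N1 \<le> r1" "card N2 \<le> r2"
    using K r1 r2 by (auto simp: N1_def N2_def U_def N_def)
  have B0: "0 \<le> B" using X[OF k, of undefined] by linarith
  define S where "S x = (\<Sum>j\<in>K. X j x)" for x
  define S1 where "S1 x = (\<Sum>j\<in>K - N1. X j x)" for x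
  define S2 where "S2 x = (\<Sum>j\<in>K - N2. X j x)" for x
  define \<eta> where "\<eta> x = (\<Sum>j\<in>N1. X j x)" for x
  define \<psi> where "\<psi> = measure_pmf.expectation P (\<lambda>x. iexp (s * S x))"
  have bound: "\<bar>\<Sum>j\<in>J. X j x\<bar> \<le> real r * B" if "J \<subseteq> K" "card J \<le> r" for J r x
  proof -
    have "\<bar>\<Sum>j\<in>J. X j x\<bar> \<le> (\<Sum>j\<in>J. B)"
      by (rule order_trans[OF sum_abs sum_mono]) (use that X in auto)
    also have "\<dots> \<le> real r * B" using that B0 by (auto intro!: mult_right_mono)
    finally show ?thesis .
  qed
  have Seq: "S x = S1 x + \<eta> x" for x
    unfolding S_def S1_def \<eta>_def using sum.subset_diff[of N1 K "\<lambda>j. X j x"] N1 K by auto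
  have Seq2: "S x = S2 x + (\<Sum>j\<in>N2. X j x)" for x
    unfolding S_def S2_def using sum.subset_diff[of N2 K "\<lambda>j. X j x"] N1 K by auto
  have Seq3: "S1 x = S2 x + (\<Sum>j\<in>N2 - N1. X j x)" for x
    using Seq[of x] Seq2[of x] sum.subset_diff[of N1 N2 "\<lambda>j. X j x"] N1 by (auto simp: \<eta>_def)
  have eta: "\<bar>\<eta> x\<bar> \<le> real r1 * B" for x unfolding \<eta>_def by (rule bound) (use N1 in auto)
  have S02: "\<bar>S x - S2 x\<bar> \<le> real r2 * B" for x unfolding Seq2 using bound[of N2 r2 x] N1 by auto
  have S12: "\<bar>S1 x - S2 x\<bar> \<le> real r2 * B" for x
    unfolding Seq3 using bound[of "N2 - N1" r2 x] N1 card_mono[of N2 "N2 - N1"] by auto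
  \<comment> \<open>\<open>S1\<close> omits every summand that shares a coordinate with
    \<open>X k\<close>, so the leading term factorises and vanishes by centring.\<close>
  have a: "measure_pmf.expectation P (\<lambda>x. complex_of_real (X k x) * iexp (s * S1 x)) = 0"
  proof -
    have "measure_pmf.expectation P (\<lambda>x. complex_of_real (X k x) * iexp (s * S1 x))
        = measure_pmf.expectation P (\<lambda>x. complex_of_real (X k x)) *
          measure_pmf.expectation P (\<lambda>x. iexp (s * S1 x))"
      unfolding P_def
    proof (rule expectation_Pi_pmf_mult_indep[OF I p])
      show "depends_on (\<lambda>x. complex_of_real (X k x)) (D k)" by (rule depends_on_comp[OF dep[OF k]])
      show "depends_on (\<lambda>x. iexp (s * S1 x)) (\<Union>j\<in>K - N1. D j)" unfolding S1_def
        by (rule depends_on_comp[of "\<lambda>x. \<Sum>j\<in>K - N1. X j x"], rule depends_on_sum,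
            rule depends_on_mono[OF dep]) auto
    qed (use D k in \<open>auto simp: N1_def N_def\<close>)
    also have "measure_pmf.expectation P (\<lambda>x. complex_of_real (X k x)) = 0"
      using mean by (simp add: P_def)
    finally show ?thesis by simp
  qed
  \<comment> \<open>\<open>iexp (s * S)\<close> is expanded around \<open>S1\<close>:
    \<open>b\<close> is the remainder after the term linear in \<open>\<eta>\<close>, and
    \<open>c\<close> is the error of replacing \<open>S1\<close> by \<open>S2\<close> in that linear
    term. The replacement is needed because \<open>\<eta>\<close> is not independent of
    \<open>S1\<close>, whereas \<open>S2\<close> avoids all coordinates in \<open>U\<close>.\<close>
  define b where "b x = X k x * iexp (s * S1 x) * (iexp (s * \<eta> x) - 1 - \<i> * (s * \<eta> x))" for x
  define c where "c x = X k x * \<eta> x * (iexp (s * S1 x) - iexp (s * S2 x))" for x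
  have d: "measure_pmf.expectation P (\<lambda>x. complex_of_real (X k x * \<eta> x) * iexp (s * S2 x))
      = measure_pmf.expectation P (\<lambda>x. X k x * \<eta> x) * measure_pmf.expectation P (\<lambda>x. iexp (s * S2 x))"
  proof -
    have "measure_pmf.expectation P (\<lambda>x. complex_of_real (X k x * \<eta> x) * iexp (s * S2 x))
        = measure_pmf.expectation P (\<lambda>x. complex_of_real (X k x * \<eta> x)) *
          measure_pmf.expectation P (\<lambda>x. iexp (s * S2 x))"
      unfolding P_def
    proof (rule expectation_Pi_pmf_mult_indep[OF I p])
      have "depends_on \<eta> U" unfolding \<eta>_def
        by (rule depends_on_sum, rule depends_on_mono[OF dep]) (use N1 in \<open>auto simp: U_def\<close>)
      moreover have "depends_on (X k) U"
        by (rule depends_on_mono[OF dep[OF k]]) (auto simp: U_def)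
      ultimately show "depends_on (\<lambda>x. complex_of_real (X k x * \<eta> x)) U"
        by (rule depends_on_comp2[rotated])
      show "depends_on (\<lambda>x. iexp (s * S2 x)) (\<Union>j\<in>K - N2. D j)" unfolding S2_def
        by (rule depends_on_comp[of "\<lambda>x. \<Sum>j\<in>K - N2. X j x"], rule depends_on_sum,
            rule depends_on_mono[OF dep]) auto
      show "U \<subseteq> I" using D k N1 by (auto simp: U_def)
    qed (auto simp: N2_def)
    then show ?thesis by (simp only: integral_complex_of_real)
  qed
  have decomp: "complex_of_real (X k x) * iexp (s * S x)
      = complex_of_real (X k x) * iexp (s * S1 x) + b x + \<i> * s * c x
        + \<i> * s * (complex_of_real (X k x * \<eta> x) * iexp (s * S2 x))" for x
  proof -
    have "iexp (s * S x) = iexp (s * S1 x) * iexp (s * \<eta> x)"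
      by (simp add: Seq distrib_left flip: exp_add)
    then show ?thesis unfolding b_def c_def by (simp add: algebra_simps)
  qed
  have Eeta: "(\<Sum>j\<in>N1. measure_pmf.expectation P (\<lambda>x. X k x * X j x))
      = measure_pmf.expectation P (\<lambda>x. X k x * \<eta> x)"
    unfolding \<eta>_def sum_distrib_left by (subst Bochner_Integration.integral_sum) (auto intro: intR)
  have "measure_pmf.expectation P (\<lambda>x. complex_of_real (X k x) * iexp (s * S x))
      = measure_pmf.expectation P b + \<i> * s * measure_pmf.expectation P c
        + \<i> * s * (measure_pmf.expectation P (\<lambda>x. X k x * \<eta> x) * measure_pmf.expectation P (\<lambda>x. iexp (s * S2 x)))"
    unfolding decomp d[symmetric] using a by (simp add: intC)
  also have "\<dots> - \<i> * s * measure_pmf.expectation P (\<lambda>x. X k x * \<eta> x) * \<psi>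
     = measure_pmf.expectation P b + \<i> * s * measure_pmf.expectation P c
        + \<i> * s * (measure_pmf.expectation P (\<lambda>x. X k x * \<eta> x)
            * measure_pmf.expectation P (\<lambda>x. iexp (s * S2 x) - iexp (s * S x)))"
    by (simp add: intC \<psi>_def algebra_simps)
  finally have eq: "measure_pmf.expectation P (\<lambda>x. complex_of_real (X k x) * iexp (s * S x))
      - \<i> * s * measure_pmf.expectation P (\<lambda>x. X k x * \<eta> x) * \<psi> = \<dots>" .
  have "norm (measure_pmf.expectation P b) \<le> B * ((\<bar>s\<bar> * (real r1 * B))\<^sup>2 / 2)"
  proof (rule norm_expectation_le[OF fin])
    fix x
    have "norm (iexp (s * \<eta> x) - 1 - \<i> * (s * \<eta> x)) \<le> \<bar>s * \<eta> x\<bar>\<^sup>2 / 2"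
      using iexp_approx1[of "s * \<eta> x" 1] by (simp add: numeral_2_eq_2 algebra_simps)
    also have "\<dots> \<le> (\<bar>s\<bar> * (real r1 * B))\<^sup>2 / 2"
      unfolding abs_mult by (intro divide_right_mono power_mono mult_left_mono eta) auto
    finally have "norm (iexp (s * \<eta> x) - 1 - \<i> * (s * \<eta> x)) \<le> (\<bar>s\<bar> * (real r1 * B))\<^sup>2 / 2" .
    then have "\<bar>X k x\<bar> * norm (iexp (s * \<eta> x) - 1 - \<i> * (s * \<eta> x)) \<le> B * ((\<bar>s\<bar> * (real r1 * B))\<^sup>2 / 2)"
      by (intro mult_mono X[OF k] B0) auto
    moreover have "norm (b x) = \<bar>X k x\<bar> * norm (iexp (s * \<eta> x) - 1 - \<i> * (s * \<eta> x))"
      unfolding b_def norm_mult norm_exp_i_times norm_of_real by simp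
    ultimately show "norm (b x) \<le> B * ((\<bar>s\<bar> * (real r1 * B))\<^sup>2 / 2)" by simp
  qed
  moreover have "norm (measure_pmf.expectation P c) \<le> B * (real r1 * B) * (\<bar>s\<bar> * (real r2 * B))"
  proof (rule norm_expectation_le[OF fin])
    fix x
    have "norm (iexp (s * S1 x) - iexp (s * S2 x)) \<le> \<bar>s\<bar> * \<bar>S1 x - S2 x\<bar>"
      using norm_iexp_diff_le[of "s * S1 x" "s * S2 x"] by (simp add: abs_mult flip: right_diff_distrib)
    also have "\<dots> \<le> \<bar>s\<bar> * (real r2 * B)" by (intro mult_left_mono S12) auto
    finally show "norm (c x) \<le> B * (real r1 * B) * (\<bar>s\<bar> * (real r2 * B))"
      unfolding c_def norm_mult of_real_mult using X[OF k, of x] eta[of x] B0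
      by (intro mult_mono) auto
  qed
  moreover have "\<bar>measure_pmf.expectation P (\<lambda>x. X k x * \<eta> x)\<bar> \<le> B * (real r1 * B)"
    using norm_expectation_le[OF fin, of "\<lambda>x. X k x * \<eta> x" "B * (real r1 * B)"]
    by (simp add: abs_mult) (meson X[OF k] eta mult_mono B0 abs_ge_zero)
  moreover have "norm (measure_pmf.expectation P (\<lambda>x. iexp (s * S2 x) - iexp (s * S x))) \<le> \<bar>s\<bar> * (real r2 * B)"
  proof (rule norm_expectation_le[OF fin])
    fix x
    have "norm (iexp (s * S2 x) - iexp (s * S x)) \<le> \<bar>s\<bar> * \<bar>S x - S2 x\<bar>"
      using norm_iexp_diff_le[of "s * S2 x" "s * S x"]
      by (simp add: abs_mult abs_minus_commute flip: right_diff_distrib)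
    also have "\<dots> \<le> \<bar>s\<bar> * (real r2 * B)" by (intro mult_left_mono S02) auto
    finally show "norm (iexp (s * S2 x) - iexp (s * S x)) \<le> \<bar>s\<bar> * (real r2 * B)" .
  qed
  \<comment> \<open>The term \<open>r1 ^ 2 / 2\<close> of the constant stems from \<open>b\<close>;
    the two terms \<open>r1 * r2\<close> stem from \<open>c\<close> and from returning from
    \<open>S2\<close> to \<open>S\<close>.\<close>
  ultimately have "norm (measure_pmf.expectation P b + \<i> * s * measure_pmf.expectation P c
        + \<i> * s * (measure_pmf.expectation P (\<lambda>x. X k x * \<eta> x)
            * measure_pmf.expectation P (\<lambda>x. iexp (s * S2 x) - iexp (s * S x))))
     \<le> B * ((\<bar>s\<bar> * (real r1 * B))\<^sup>2 / 2) + \<bar>s\<bar> * (B * (real r1 * B) * (\<bar>s\<bar> * (real r2 * B)))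
        + \<bar>s\<bar> * (B * (real r1 * B) * (\<bar>s\<bar> * (real r2 * B)))"
    by (intro norm_triangle_le add_mono)
       (auto simp: norm_mult B0 intro!: mult_mono)
  also have "\<dots> = (real r1 ^ 2 / 2 + 2 * real r1 * real r2) * B ^ 3 * s\<^sup>2"
    by (simp add: power2_eq_square power3_eq_cube field_simps)
  finally show ?thesis
    unfolding P_def[symmetric] N1_def[symmetric] S_def[symmetric] \<psi>_def[symmetric] Eeta eq .
qed

text \<open>Summing the previous estimate over \<open>k\<close> gives
  \<open>\<psi>' s = - V * s * \<psi> s\<close> up to an error \<open>C * s\<^sup>2\<close>. The
  integrating factor \<open>exp (V * s\<^sup>2 / 2)\<close> makes this a bound for the derivative of
  \<open>F\<close>, and the mean value inequality on the segment from \<open>0\<close> to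
  \<open>s\<close> yields the claim.\<close>

lemma char_local_dependence:
  fixes X :: "'k \<Rightarrow> ('i \<Rightarrow> 'a) \<Rightarrow> real" and D :: "'k \<Rightarrow> 'i set"
  defines "N \<equiv> \<lambda>K k. {j\<in>K. D j \<inter> D k \<noteq> {}}"
  assumes I: "finite I" and p: "\<And>i. i \<in> I \<Longrightarrow> finite (set_pmf (p i))"
    and K: "finite K" and dep: "\<And>k. k \<in> K \<Longrightarrow> depends_on (X k) (D k)"
    and D: "\<And>k. k \<in> K \<Longrightarrow> D k \<subseteq> I"
    and X: "\<And>k x. k \<in> K \<Longrightarrow> \<bar>X k x\<bar> \<le> B"
    and mean: "\<And>k. k \<in> K \<Longrightarrow> measure_pmf.expectation (Pi_pmf I d p) (X k) = 0"
    and r1: "\<And>k. k \<in> K \<Longrightarrow> card (N K k) \<le> r1"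
    and r2: "\<And>k. k \<in> K \<Longrightarrow> card {j\<in>K. D j \<inter> (D k \<union> (\<Union>i\<in>N K k. D i)) \<noteq> {}} \<le> r2"
    and V: "(\<Sum>k\<in>K. \<Sum>j\<in>N K k. measure_pmf.expectation (Pi_pmf I d p) (\<lambda>x. X k x * X j x)) = V"
    and V0: "0 \<le> V"
  shows "norm (measure_pmf.expectation (Pi_pmf I d p) (\<lambda>x. iexp (s * (\<Sum>j\<in>K. X j x))) - exp (- V * s\<^sup>2 / 2))
    \<le> real (card K) * ((real r1 ^ 2 / 2 + 2 * real r1 * real r2) * B ^ 3) * \<bar>s\<bar> ^ 3"
proof -
  define P where "P = Pi_pmf I d p"
  have fin: "finite (set_pmf P)" unfolding P_def by (rule finite_set_Pi_pmf[OF I p])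
  note intC = integrable_measure_pmf_finite[OF fin, where 'b = complex]
  define S where "S x = (\<Sum>j\<in>K. X j x)" for x
  define \<psi> where "\<psi> s = measure_pmf.expectation P (\<lambda>x. iexp (s * S x))" for s :: real
  define \<psi>' where "\<psi>' s = measure_pmf.expectation P (\<lambda>x. \<i> * S x * iexp (s * S x))" for s :: real
  define C where "C = real (card K) * ((real r1 ^ 2 / 2 + 2 * real r1 * real r2) * B ^ 3)"
  have der: "(\<psi> has_vector_derivative \<psi>' s) (at s within A)" for s A
  proof -
    \<comment> \<open>Finite support makes the expectation a finite sum, so differentiation may be
      done term by term.\<close>
    have eq: "measure_pmf.expectation P f = (\<Sum>x\<in>set_pmf P. pmf P x *\<^sub>R f x)" for f :: "_ \<Rightarrow> complex"
      by (rule integral_measure_pmf[OF fin]) auto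
    show ?thesis unfolding \<psi>_def[abs_def] \<psi>'_def eq
      by (auto intro!: derivative_eq_intros has_vector_derivative_real_field sum.cong
          simp: scaleR_conv_of_real mult_ac)
  qed
  have bnd: "norm (\<psi>' s + V * s * \<psi> s) \<le> C * s\<^sup>2" for s
  proof -
    have "\<psi>' s = \<i> * (\<Sum>k\<in>K. measure_pmf.expectation P (\<lambda>x. X k x * iexp (s * S x)))"
      unfolding \<psi>'_def S_def by (simp add: sum_distrib_left sum_distrib_right intC mult_ac)
    moreover have "complex_of_real V = (\<Sum>k\<in>K. \<Sum>j\<in>N K k. measure_pmf.expectation P (\<lambda>x. X k x * X j x))"
      unfolding P_def V ..
    moreover have "\<i> * (\<i> * z) = - z" for z by (simp flip: mult.assoc)
    ultimately have "\<psi>' s + V * s * \<psi> s = \<i> * (\<Sum>k\<in>K. measure_pmf.expectation P (\<lambda>x. X k x * iexp (s * S x))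
        - \<i> * s * (\<Sum>j\<in>N K k. measure_pmf.expectation P (\<lambda>x. X k x * X j x)) * \<psi> s)"
      by (simp add: sum_subtractf algebra_simps sum_distrib_left sum_distrib_right sum_negf)
    also have "norm \<dots> \<le> (\<Sum>k\<in>K. (real r1 ^ 2 / 2 + 2 * real r1 * real r2) * B ^ 3 * s\<^sup>2)"
      unfolding norm_mult norm_ii mult_1
    proof (rule order_trans[OF norm_sum sum_mono])
      fix k assume k: "k \<in> K"
      show "norm (measure_pmf.expectation P (\<lambda>x. X k x * iexp (s * S x))
        - \<i> * s * (\<Sum>j\<in>N K k. measure_pmf.expectation P (\<lambda>x. X k x * X j x)) * \<psi> s)
        \<le> (real r1 ^ 2 / 2 + 2 * real r1 * real r2) * B ^ 3 * s\<^sup>2"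
        unfolding \<psi>_def S_def P_def N_def
        by (rule local_dependence_step[where X = X and D = D and k = k, OF I p K dep D X mean[OF k] _ _ k])
           (use r1[OF k] r2[OF k] in \<open>auto simp: N_def\<close>)
    qed
    finally show ?thesis by (simp add: C_def)
  qed
  have C0: "C \<ge> 0" using order_trans[OF norm_ge_zero bnd[of 1]] by simp
  define F where "F s = \<psi> s * exp (V * s\<^sup>2 / 2)" for s :: real
  have derF: "(F has_vector_derivative (\<psi>' u + V * u * \<psi> u) * exp (V * u\<^sup>2 / 2)) (at u within A)" for u A
  proof -
    have "((\<lambda>u. complex_of_real (exp (V * u\<^sup>2 / 2))) has_vector_derivative
        complex_of_real (V * u * exp (V * u\<^sup>2 / 2))) (at u within A)"
      by (rule has_vector_derivative_of_real)
         (auto intro!: derivative_eq_intros simp flip: has_real_derivative_iff_has_vector_derivative)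
    from has_vector_derivative_mult[OF der this] show ?thesis
      unfolding F_def[abs_def] by (simp add: algebra_simps)
  qed
  have "norm (F s - F 0) \<le> C * s\<^sup>2 * exp (V * s\<^sup>2 / 2) * norm (s - 0)"
  proof (rule differentiable_bound[of "closed_segment 0 s"])
    fix u assume u: "u \<in> closed_segment 0 s"
    then have us: "\<bar>u\<bar> \<le> \<bar>s\<bar>" by (auto simp: closed_segment_eq_real_ivl split: if_splits)
    show "(F has_derivative (\<lambda>h. h *\<^sub>R ((\<psi>' u + V * u * \<psi> u) * exp (V * u\<^sup>2 / 2)))) (at u within closed_segment 0 s)"
      using derF unfolding has_vector_derivative_def .
    have "u\<^sup>2 \<le> s\<^sup>2" using us by (simp add: abs_le_square_iff)
    \<comment> \<open>As \<open>V\<close> is nonnegative, the weight at \<open>u\<close> is at most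
      the weight at \<open>s\<close>; the latter cancels at the end, so no exponential growth
      remains in the error.\<close>
    then have "norm (\<psi>' u + V * u * \<psi> u) \<le> C * s\<^sup>2"
      by (intro order_trans[OF bnd mult_left_mono[OF _ C0]])
    with \<open>u\<^sup>2 \<le> s\<^sup>2\<close> have "norm ((\<psi>' u + V * u * \<psi> u) * exp (V * u\<^sup>2 / 2)) \<le> C * s\<^sup>2 * exp (V * s\<^sup>2 / 2)"
      unfolding norm_mult using C0 V0
      by (auto intro!: mult_mono mult_left_mono)
    then show "onorm (\<lambda>h. h *\<^sub>R ((\<psi>' u + V * u * \<psi> u) * exp (V * u\<^sup>2 / 2))) \<le> C * s\<^sup>2 * exp (V * s\<^sup>2 / 2)"
      by (intro onorm_le) (auto intro!: mult_left_mono simp: mult.commute)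
  qed auto
  also have "F 0 = 1" by (simp add: F_def \<psi>_def)
  also have "F s - 1 = exp (V * s\<^sup>2 / 2) * (\<psi> s - exp (- V * s\<^sup>2 / 2))"
    by (simp add: F_def algebra_simps flip: of_real_mult exp_add)
  finally have "exp (V * s\<^sup>2 / 2) * norm (\<psi> s - exp (- V * s\<^sup>2 / 2)) \<le> exp (V * s\<^sup>2 / 2) * (C * \<bar>s\<bar> ^ 3)"
    by (simp add: norm_mult mult_ac power3_eq_cube power2_eq_square)
  then show ?thesis by (simp add: \<psi>_def S_def P_def C_def)
qed

subsection \<open>Isolated ones on the cycle\<close>

text \<open>The pattern zero, one, zero starting at \<open>k\<close>, for an arbitrary colouring
  \<open>b\<close>: the same function is evaluated at the permutation configuration, at iid coins
  and at thresholds of the three-colouring.\<close>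

definition iso :: "nat \<Rightarrow> nat \<Rightarrow> (nat \<Rightarrow> bool) \<Rightarrow> real" where
  "iso n k b = of_bool (\<not> b (cyc n k) \<and> b (cyc n (k + 1)) \<and> \<not> b (cyc n (k + 2)))"

definition isolated :: "nat \<Rightarrow> (nat \<Rightarrow> bool) \<Rightarrow> real" where
  "isolated n b = (\<Sum>k = 1..n. iso n k b)"

definition triple :: "nat \<Rightarrow> nat \<Rightarrow> nat set" where
  "triple n k = {cyc n k, cyc n (k + 1), cyc n (k + 2)}"

lemma X1_eq_isolated: "X1 n m \<sigma> = isolated n (\<lambda>k. inv \<sigma> k \<le> m)"
  unfolding X1_def isolated_def iso_def I_ind_def by (intro sum.cong) auto

lemma cyc_in: "n > 0 \<Longrightarrow> cyc n k \<in> {1..n}"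
  by (auto simp: cyc_def dvd_eq_mod_eq_0 intro: less_imp_le)

lemma cyc_id: "k \<in> {1..n} \<Longrightarrow> cyc n k = k"
  by (cases "k = n") (auto simp: cyc_def dest: dvd_imp_le)

lemma cyc_eq_iff: "n > 0 \<Longrightarrow> cyc n a = cyc n b \<longleftrightarrow> a mod n = b mod n"
  using mod_less_divisor[of n a] mod_less_divisor[of n b]
  unfolding cyc_def dvd_eq_mod_eq_0 by (metis less_irrefl)

lemma cyc_mod: "cyc n k mod n = k mod n"
  by (cases "n dvd k") (simp_all add: cyc_def)

lemma cyc_cyc_add: "n > 0 \<Longrightarrow> cyc n (cyc n a + i) = cyc n (a + i)"
  unfolding cyc_eq_iff by (rule mod_add_cong[OF cyc_mod refl])

lemma iso_cyc: "n > 0 \<Longrightarrow> iso n (cyc n a) b = iso n a b"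
  using cyc_cyc_add[of n a 0] by (simp add: iso_def cyc_cyc_add del: add_2_eq_Suc' One_nat_def)

lemma cyc_cong: "a mod n = b mod n \<Longrightarrow> cyc n a = cyc n b"
  by (simp add: cyc_def dvd_eq_mod_eq_0)

lemma iso_add_self: "iso n (a + n) b = iso n a b"
proof -
  have "cyc n (a + n + i) = cyc n (a + i)" for i
    by (rule cyc_cong) (metis add.assoc add.commute mod_add_self2)
  from this[of 0] this[of 1] this[of 2] show ?thesis by (simp add: iso_def)
qed

lemma iso_bounds: "0 \<le> iso n k b" "iso n k b \<le> 1"
  by (auto simp: iso_def)

lemma isolated_bounds: "0 \<le> isolated n b" "isolated n b \<le> real n"
proof -
  show "0 \<le> isolated n b" unfolding isolated_def by (intro sum_nonneg iso_bounds)
  have "isolated n b \<le> (\<Sum>k = 1..n. 1)" unfolding isolated_def by (intro sum_mono iso_bounds)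
  then show "isolated n b \<le> real n" by simp
qed

lemma isolated_cong: "n > 0 \<Longrightarrow> (\<And>k. k \<in> {1..n} \<Longrightarrow> b k = b' k) \<Longrightarrow> isolated n b = isolated n b'"
  unfolding isolated_def iso_def using cyc_in by (intro sum.cong) auto

lemma depends_on_iso: "depends_on (iso n k) (triple n k)"
  by (auto simp: depends_on_def iso_def triple_def)

lemma depends_on_iso_comp: "depends_on (\<lambda>c. iso n k (\<lambda>i. B (c i))) (triple n k)"
  by (auto simp: depends_on_def iso_def triple_def)

lemma triple_subset: "n > 0 \<Longrightarrow> triple n k \<subseteq> {1..n}"
  unfolding triple_def using cyc_in by auto

lemma triple_eq: "triple n k = (\<lambda>i. cyc n (k + i)) ` {..2}"
  by (auto simp: triple_def atMost_Suc numeral_2_eq_2)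

text \<open>Two windows of length 3 meet exactly when their starting points are at cyclic distance
  at most 2. The five starting points from \<open>k - 2\<close> to \<open>k + 2\<close> are written
  as \<open>k + n - 2 + i\<close> to stay within the natural numbers.\<close>

lemma triple_meets_iff:
  assumes n: "n \<ge> 2" and j: "j \<in> {1..n}"
  shows "triple n j \<inter> triple n k \<noteq> {} \<longleftrightarrow> j \<in> (\<lambda>i. cyc n (k + n - 2 + i)) ` {..<5}"
proof
  assume "triple n j \<inter> triple n k \<noteq> {}"
  then obtain a b where ab: "a \<le> 2" "b \<le> 2" "cyc n (j + a) = cyc n (k + b)"
    by (auto simp: triple_eq)
  have "(j + a) mod n = (k + b) mod n" using ab n by (simp add: cyc_eq_iff)
  then have "(j + a + (n - a)) mod n = (k + b + (n - a)) mod n" by (metis mod_add_left_eq)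
  then have "j mod n = (k + n - 2 + (b + 2 - a)) mod n" using ab n by (simp add: algebra_simps)
  then have "cyc n j = cyc n (k + n - 2 + (b + 2 - a))" by (rule cyc_cong)
  then show "j \<in> (\<lambda>i. cyc n (k + n - 2 + i)) ` {..<5}" using ab cyc_id[OF j]
    by (intro image_eqI[of _ _ "b + 2 - a"]) auto
next
  assume "j \<in> (\<lambda>i. cyc n (k + n - 2 + i)) ` {..<5}"
  then obtain i where i: "i < 5" "j = cyc n (k + n - 2 + i)" by auto
  have "\<exists>a\<le>2. \<exists>b\<le>2. i + a = b + 2"
  proof (cases "i \<le> 2")
    case True then show ?thesis by (intro exI[of _ "2 - i"] conjI exI[of _ 0]) auto
  next
    case False then show ?thesis using i by (intro exI[of _ 0] conjI exI[of _ "i - 2"]) auto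
  qed
  then obtain a b where ab: "a \<le> 2" "b \<le> 2" "i + a = b + 2" by blast
  have "cyc n (j + a) = cyc n (k + n - 2 + i + a)" using i n by (simp add: cyc_cyc_add)
  also have "k + n - 2 + i + a = k + b + n" using ab n by simp
  also have "cyc n (k + b + n) = cyc n (k + b)" by (rule cyc_cong) simp
  finally show "triple n j \<inter> triple n k \<noteq> {}" using ab by (auto simp: triple_eq)
qed

lemma card_triple_meets:
  assumes "n \<ge> 2"
  shows "card {j\<in>{1..n}. triple n j \<inter> triple n k \<noteq> {}} \<le> 5"
proof -
  have "{j\<in>{1..n}. triple n j \<inter> triple n k \<noteq> {}} \<subseteq> (\<lambda>i. cyc n (k + n - 2 + i)) ` {..<5}"
    using triple_meets_iff[OF assms] by auto
  then have "card {j\<in>{1..n}. triple n j \<inter> triple n k \<noteq> {}} \<le> card ((\<lambda>i. cyc n (k + n - 2 + i)) ` {..<5})"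
    by (intro card_mono) auto
  also have "\<dots> \<le> 5" using card_image_le[of "{..<5::nat}"] by (metis card_lessThan finite_lessThan)
  finally show ?thesis .
qed

text \<open>As \<open>k\<close> is its own neighbour, a window that meets the enlarged neighbourhood
  is a neighbour of a neighbour, which leaves at most \<open>5 * 5\<close> of them. The value enters
  only the constant of the error term.\<close>

lemma card_triple_meets2:
  assumes "n \<ge> 2" "k \<in> {1..n}"
  shows "card {j\<in>{1..n}. triple n j \<inter> (triple n k \<union>
      (\<Union>i\<in>{j\<in>{1..n}. triple n j \<inter> triple n k \<noteq> {}}. triple n i)) \<noteq> {}} \<le> 25"
proof -
  define N where "N k = {j\<in>{1..n}. triple n j \<inter> triple n k \<noteq> {}}" for k
  have fin: "finite (N k)" for k by (simp add: N_def)
  have c: "card (N k) \<le> 5" for k using card_triple_meets[OF assms(1)] by (simp add: N_def)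
  have "k \<in> N k" using assms by (auto simp: N_def triple_def)
  then have "{j\<in>{1..n}. triple n j \<inter> (triple n k \<union> (\<Union>i\<in>N k. triple n i)) \<noteq> {}} \<subseteq> (\<Union>i\<in>N k. N i)"
    by (auto simp: N_def)
  then have "card {j\<in>{1..n}. triple n j \<inter> (triple n k \<union> (\<Union>i\<in>N k. triple n i)) \<noteq> {}} \<le> card (\<Union>i\<in>N k. N i)"
    using fin by (intro card_mono) auto
  also have "\<dots> \<le> (\<Sum>i\<in>N k. card (N i))" by (rule card_UN_le[OF fin])
  also have "\<dots> \<le> card (N k) * 5" using sum_bounded_above[of "N k" "\<lambda>i. card (N i)" 5] c by simp
  also have "\<dots> \<le> 25" using c[of k] by simp
  finally show ?thesis unfolding N_def .
qed

text \<open>Residues modulo 3 separate the triples, except across the seam of the cycle when \<open>3\<close> does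
  not divide \<open>n\<close>; the at most two leftover positions get classes of their own.\<close>

definition tclass :: "nat \<Rightarrow> nat \<Rightarrow> nat" where
  "tclass n k = (if k \<le> 3 * (n div 3) then k mod 3 else 3 + k mod 3)"

lemma tclass_less: "tclass n k < 6"
  unfolding tclass_def using mod_less_divisor[of 3 k] by (simp del: mod_less_divisor)

text \<open>Equal classes force \<open>k \<ge> j + 3\<close>, so the windows could only meet across
  the seam, that is with \<open>k + b \<ge> n + j + a\<close>. In the main block
  \<open>k + 3 \<le> n + j\<close> excludes this. The leftover positions lie closer than 3 to each
  other, so two of them never share a class.\<close>

lemma tclass_disjoint_less:
  assumes j: "j \<in> {1..n}" and k: "k \<in> {1..n}" and "j < k" and eq: "tclass n j = tclass n k"
  shows "triple n j \<inter> triple n k = {}"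
proof (rule ccontr)
  assume "triple n j \<inter> triple n k \<noteq> {}"
  then obtain a b where ab: "a \<le> 2" "b \<le> 2" "cyc n (j + a) = cyc n (k + b)"
    by (auto simp: triple_eq)
  have n: "n \<ge> 2" using j k \<open>j < k\<close> by auto
  have "(j + a) mod n = (k + b) mod n" using ab n by (simp add: cyc_eq_iff)
  then have "int n dvd int (k + b) - int (j + a)"
    by (metis mod_eq_dvd_iff of_nat_mod)
  then obtain t where t: "int (k + b) - int (j + a) = int n * t" by (auto simp: dvd_def)
  have side': "tclass n i < 3 \<longleftrightarrow> i \<le> 3 * (n div 3)" for i unfolding tclass_def by simp
  have side: "j \<le> 3 * (n div 3) \<longleftrightarrow> k \<le> 3 * (n div 3)" using side'[of j] side'[of k] eq by simp
  then have m3: "j mod 3 = k mod 3" using eq unfolding tclass_def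
    by (cases "j \<le> 3 * (n div 3)") (simp_all only: if_True if_False simp_thms add_left_cancel)
  then obtain d where d: "k = j + 3 * d" using mod_eq_dvd_iff_nat[of j k 3] \<open>j < k\<close>
    by (auto elim!: dvdE simp: le_imp_diff_is_add)
  then have kj: "k \<ge> j + 3" using \<open>j < k\<close> by (cases d) auto
  have "t > 0"
  proof (rule ccontr)
    assume "\<not> t > 0"
    then have "int n * t \<le> 0" by (simp add: mult_nonneg_nonpos)
    then show False using t kj ab by linarith
  qed
  then have "int n * 1 \<le> int n * t" by (intro mult_left_mono) auto
  then have le: "k + b \<ge> n + j + a" using t by linarith
  show False
  proof (cases "k \<le> 3 * (n div 3)")
    case True
    have "d < n div 3" using True d j by simp
    then have "k + 3 \<le> 3 * (n div 3) + j" using d by simp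
    moreover have "3 * (n div 3) \<le> n" by simp
    ultimately show False using le ab by linarith
  next
    case False
    then have "j > 3 * (n div 3)" using side by simp
    then have "k < j + 3"
    proof -
      have "n mod 3 < 3" by simp
      with \<open>j > 3 * (n div 3)\<close> k mult_div_mod_eq[of 3 n] show ?thesis
        unfolding atLeastAtMost_iff by linarith
    qed
    then show False using kj by simp
  qed
qed

lemma tclass_disjoint:
  assumes "j \<in> {1..n}" "k \<in> {1..n}" "j \<noteq> k" "tclass n j = tclass n k"
  shows "triple n j \<inter> triple n k = {}"
  using tclass_disjoint_less[of j n k] tclass_disjoint_less[of k n j] assms
  by (cases "j < k") auto

text \<open>The six classes of \<open>tclass\<close> are the origin of the constant
  \<open>12 = 2 * 6\<close> in all later exponents.\<close>

lemma exp_abs_moment_cyclic: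
  fixes h :: "nat \<Rightarrow> (nat \<Rightarrow> 'a) \<Rightarrow> real"
  assumes n: "n > 0" and q: "finite (set_pmf q)"
    and dep: "\<And>k. depends_on (h k) (triple n k)"
    and h: "\<And>k x. \<bar>h k x\<bar> \<le> 1"
    and v: "\<And>k. measure_pmf.expectation (Pi_pmf {1..n} d (\<lambda>_. q)) (\<lambda>x. (h k x)\<^sup>2) \<le> v"
    and s: "real n * v \<le> s\<^sup>2" "1 \<le> s"
  shows "measure_pmf.expectation (Pi_pmf {1..n} d (\<lambda>_. q))
      (\<lambda>x. exp (\<bar>(\<Sum>k = 1..n. h k x) - (\<Sum>k = 1..n. measure_pmf.expectation (Pi_pmf {1..n} d (\<lambda>_. q)) (h k))\<bar> / (12 * s))) \<le> 3"
proof -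
  have v0: "0 \<le> v" by (rule order_trans[OF _ v[of 0]]) simp
  have "measure_pmf.expectation (Pi_pmf {1..n} d (\<lambda>_. q))
      (\<lambda>x. exp (\<bar>\<Sum>k\<in>{1..n}. h k x - measure_pmf.expectation (Pi_pmf {1..n} d (\<lambda>_. q)) (h k)\<bar> / (2 * real 6 * s))) \<le> 3"
    by (rule exp_abs_moment_local_sum[where D = "triple n" and \<kappa> = "tclass n" and v = v])
       (use q dep h v v0 s triple_subset[OF n] tclass_less tclass_disjoint in auto)
  then show ?thesis by (simp add: sum_subtractf)
qed

section \<open>Means and covariances of isolated ones in an iid colouring\<close>

lemma add_mod_inj:
  fixes i j k n :: nat
  assumes "i < n" "j < n" "(k + i) mod n = (k + j) mod n"
  shows "i = j"
proof (rule linorder_cases[of i j])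
  assume "i < j"
  then have "n dvd j - i" using assms mod_eq_dvd_iff_nat[of "k + i" "k + j" n] by simp
  with \<open>i < j\<close> assms(1,2) show ?thesis using nat_dvd_not_less[of "j - i" n] by simp
next
  assume "j < i"
  then have "n dvd i - j" using assms mod_eq_dvd_iff_nat[of "k + j" "k + i" n] by simp
  with \<open>j < i\<close> assms(1,2) show ?thesis using nat_dvd_not_less[of "i - j" n] by simp
qed

lemma expectation_of_bool:
  "measure_pmf.expectation q (\<lambda>x. of_bool (P x) :: real) = measure q {x. P x}"
proof -
  have "(\<lambda>x. of_bool (P x) :: real) = indicator {x. P x}" by (auto simp: indicator_def)
  then show ?thesis by simp
qed

text \<open>\<open>w\<close> prescribes the bits of \<open>l\<close> consecutive positions, which
  are distinct because \<open>l \<le> n\<close>. The predicate \<open>B\<close> reduces an arbitrary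
  set of colours to bits, so that the thresholds of the three-colouring are covered too.\<close>

lemma expectation_cylinder:
  fixes q :: "'a pmf" and B :: "'a \<Rightarrow> bool"
  assumes q: "finite (set_pmf q)" and l: "l \<le> n" and n: "n > 0"
  shows "measure_pmf.expectation (Pi_pmf {1..n} d (\<lambda>_. q)) (\<lambda>c. \<Prod>i<l. of_bool (B (c (cyc n (k + i))) = w i) :: real)
     = (\<Prod>i<l. if w i then measure q {x. B x} else 1 - measure q {x. B x})"
proof -
  have "measure_pmf.expectation (Pi_pmf {1..n} d (\<lambda>_. q)) (\<lambda>c. \<Prod>i<l. of_bool (B (c (cyc n (k + i))) = w i) :: real)
     = (\<Prod>i<l. measure_pmf.expectation (Pi_pmf {1..n} d (\<lambda>_. q)) (\<lambda>c. of_bool (B (c (cyc n (k + i))) = w i)))"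
  proof (rule expectation_Pi_pmf_prod_indep[where D = "\<lambda>i. {cyc n (k + i)}"])
    fix i j assume ij: "i \<in> {..<l}" "j \<in> {..<l}" "i \<noteq> j"
    have "(k + i) mod n \<noteq> (k + j) mod n" using add_mod_inj[of i n j k] ij l by auto
    then show "{cyc n (k + i)} \<inter> {cyc n (k + j)} = {}" using n by (auto simp: cyc_eq_iff)
  qed (use q cyc_in[OF n] in \<open>auto simp: depends_on_def\<close>)
  also have "\<dots> = (\<Prod>i<l. if w i then measure q {x. B x} else 1 - measure q {x. B x})"
  proof (rule prod.cong[OF refl])
    fix i
    have "measure_pmf.expectation (Pi_pmf {1..n} d (\<lambda>_. q)) (\<lambda>c. of_bool (B (c (cyc n (k + i))) = w i) :: real)
        = measure_pmf.expectation (map_pmf (\<lambda>c. c (cyc n (k + i))) (Pi_pmf {1..n} d (\<lambda>_. q))) (\<lambda>x. of_bool (B x = w i))"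
      by simp
    also have "map_pmf (\<lambda>c. c (cyc n (k + i))) (Pi_pmf {1..n} d (\<lambda>_. q)) = q"
      using cyc_in[OF n] by (subst Pi_pmf_component) auto
    also have "measure_pmf.expectation q (\<lambda>x. of_bool (B x = w i) :: real) = measure q {x. B x = w i}"
      by (rule expectation_of_bool)
    also have "measure q {x. B x = w i} = (if w i then measure q {x. B x} else 1 - measure q {x. B x})"
      using measure_pmf.prob_compl[of "{x. B x}" q] by (auto simp: Compl_eq_Diff_UNIV[symmetric] Collect_neg_eq)
    finally show "measure_pmf.expectation (Pi_pmf {1..n} d (\<lambda>_. q)) (\<lambda>c. of_bool (B (c (cyc n (k + i))) = w i) :: real)
       = (if w i then measure q {x. B x} else 1 - measure q {x. B x})" .
  qed
  finally show ?thesis .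
qed

lemma prod_lessThan_3: "(\<Prod>i<3::nat. f i) = f 0 * f 1 * (f 2 :: real)"
  by (simp add: numeral_eq_Suc lessThan_Suc)

lemma prod_lessThan_5: "(\<Prod>i<5::nat. f i) = f 0 * f 1 * f 2 * f 3 * (f 4 :: real)"
  by (simp add: numeral_eq_Suc lessThan_Suc)

lemma expectation_iso:
  fixes q :: "'a pmf" and B :: "'a \<Rightarrow> bool"
  assumes q: "finite (set_pmf q)" and n: "n \<ge> 3"
  defines "p \<equiv> measure q {x. B x}"
  shows "measure_pmf.expectation (Pi_pmf {1..n} d (\<lambda>_. q)) (\<lambda>c. iso n k (\<lambda>i. B (c i))) = p * (1 - p)\<^sup>2"
proof -
  have "iso n k (\<lambda>i. B (c i)) = (\<Prod>i<3. of_bool (B (c (cyc n (k + i))) = (i = 1)))" for c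
    unfolding prod_lessThan_3 iso_def of_bool_conj by simp
  then show ?thesis using expectation_cylinder[OF q, of 3 n d B k "\<lambda>i. i = 1"] n
    by (simp add: p_def prod_lessThan_3 power2_eq_square)
qed

text \<open>Two patterns at distance 2 share a zero and form the word 0 1 0 1 0 with two ones and
  three zeros.\<close>

lemma expectation_iso_mult:
  fixes q :: "'a pmf" and B :: "'a \<Rightarrow> bool"
  assumes q: "finite (set_pmf q)" and n: "n \<ge> 5"
  defines "p \<equiv> measure q {x. B x}"
  shows "measure_pmf.expectation (Pi_pmf {1..n} d (\<lambda>_. q))
      (\<lambda>c. iso n k (\<lambda>i. B (c i)) * iso n (k + 2) (\<lambda>i. B (c i))) = p\<^sup>2 * (1 - p) ^ 3"
proof -
  have e: "k + 2 + 1 = k + 3" "k + 2 + 2 = k + 4" by auto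
  have "iso n k (\<lambda>i. B (c i)) * iso n (k + 2) (\<lambda>i. B (c i))
      = (\<Prod>i<5. of_bool (B (c (cyc n (k + i))) = (i = 1 \<or> i = 3)))" for c
    unfolding prod_lessThan_5 iso_def e
    by (cases "B (c (cyc n (k + 2)))"; cases "B (c (cyc n k))"; cases "B (c (cyc n (k + 4)))")
       (simp_all del: add_2_eq_Suc' One_nat_def)
  then show ?thesis using expectation_cylinder[OF q, of 5 n d B k "\<lambda>i. i = 1 \<or> i = 3"] n
    by (simp add: p_def prod_lessThan_5 power2_eq_square power3_eq_cube mult_ac)
qed

lemma sum_lessThan_5: "(\<Sum>i<5::nat. f i) = f 0 + f 1 + f 2 + f 3 + (f 4 :: real)"
  by (simp add: numeral_eq_Suc lessThan_Suc)

lemma measure_bernoulli_True: "0 \<le> p \<Longrightarrow> p \<le> 1 \<Longrightarrow> measure (bernoulli_pmf p) {x. x} = p"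
proof -
  have "{x. x} = {True}" by auto
  then show "0 \<le> p \<Longrightarrow> p \<le> 1 \<Longrightarrow> ?thesis" by (simp add: measure_pmf_single)
qed

text \<open>Each \<open>k\<close> has five neighbours, distinct as \<open>n \<ge> 5\<close>, whose
  products with it have the means \<open>4/27\<close> (itself), \<open>0\<close> (distance 1) and
  \<open>8/243\<close> (distance 2). Subtracting \<open>(4/27)\<^sup>2 = 16/729\<close> from each
  gives \<open>4/27 + 2 * 8/243 - 5 * 16/729 = 76/729\<close>.\<close>

lemma char_isolated_bernoulli:
  assumes n: "n \<ge> 5"
  shows "norm (measure_pmf.expectation (Pi_pmf {1..n} False (\<lambda>_. bernoulli_pmf (1/3)))
        (\<lambda>b. iexp (s * (isolated n b - 4/27 * real n))) - exp (- (76/729 * real n) * s\<^sup>2 / 2))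
      \<le> real n * 263 * \<bar>s\<bar> ^ 3"
proof -
  define q where "q = bernoulli_pmf (1/3)"
  define P where "P = Pi_pmf {1..n} False (\<lambda>_. q)"
  have q: "finite (set_pmf q)" unfolding q_def by (rule finite_subset[OF subset_UNIV]) simp
  have fin: "finite (set_pmf P)" unfolding P_def by (rule finite_set_Pi_pmf) (use q in auto)
  note int = integrable_measure_pmf_finite[OF fin, where 'b = real]
  have m: "measure q {x. x} = 1/3" unfolding q_def by (rule measure_bernoulli_True) auto
  define X where "X k b = iso n k b - 4/27" for k and b :: "nat \<Rightarrow> bool"
  have E1: "measure_pmf.expectation P (iso n k) = 4/27" for k
    using expectation_iso[where B = "\<lambda>x. x" and q = q and d = False and n = n and k = k, OF q] n
    by (simp add: P_def m power2_eq_square)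
  have E2: "measure_pmf.expectation P (\<lambda>b. iso n k b * iso n (k + 2) b) = 8/243" for k
    using expectation_iso_mult[where B = "\<lambda>x. x" and q = q and d = False and n = n and k = k, OF q] n
    by (simp add: P_def m power2_eq_square power3_eq_cube)
  have cov: "measure_pmf.expectation P (\<lambda>b. X j b * X k b)
      = measure_pmf.expectation P (\<lambda>b. iso n j b * iso n k b) - 16/729" for j k
  proof -
    have "X j b * X k b = iso n j b * iso n k b - 4/27 * iso n j b - 4/27 * iso n k b + 16/729" for b
      by (simp add: X_def algebra_simps)
    then show ?thesis by (simp add: int E1)
  qed
  have c0: "measure_pmf.expectation P (\<lambda>b. X k b * X k b) = 4/27 - 16/729" for k
  proof -
    have "iso n k b * iso n k b = iso n k b" for b by (auto simp: iso_def)
    then show ?thesis by (simp only: cov E1)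
  qed
  \<comment> \<open>Adjacent patterns exclude each other: position \<open>k + 1\<close> would have
    to be a one for the first and a zero for the second.\<close>
  have c1: "measure_pmf.expectation P (\<lambda>b. X k b * X (k + 1) b) = - 16/729" for k
  proof -
    have "iso n k b * iso n (k + 1) b = 0" for b by (auto simp: iso_def)
    then show ?thesis by (simp only: cov) simp
  qed
  have c2: "measure_pmf.expectation P (\<lambda>b. X k b * X (k + 2) b) = 8/243 - 16/729" for k
    unfolding cov E2 ..
  have Xcyc: "X (cyc n a) = X a" for a using iso_cyc[of n a] n by (auto simp: X_def)
  have Xn: "X (a + n) = X a" for a using iso_add_self[of n a] by (auto simp: X_def)
  have V: "(\<Sum>j\<in>{j\<in>{1..n}. triple n j \<inter> triple n k \<noteq> {}}. measure_pmf.expectation P (\<lambda>b. X k b * X j b)) = 76/729"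
    for k
  proof -
    have "{j\<in>{1..n}. triple n j \<inter> triple n k \<noteq> {}} = (\<lambda>i. cyc n (k + n - 2 + i)) ` {..<5}"
      (is "?N = ?J")
    proof (rule set_eqI)
      fix j
      have "j \<in> ?J \<Longrightarrow> j \<in> {1..n}" using n by (auto simp only: image_iff intro!: cyc_in)
      moreover have "2 \<le> n" using n by simp
      ultimately show "j \<in> ?N \<longleftrightarrow> j \<in> ?J" using triple_meets_iff[of n j k] by blast
    qed
    moreover have "inj_on (\<lambda>i. cyc n (k + n - 2 + i)) {..<5}"
    proof (rule inj_onI)
      fix i j assume "i \<in> {..<5}" "j \<in> {..<5}" "cyc n (k + n - 2 + i) = cyc n (k + n - 2 + j)"
      then show "i = j" using add_mod_inj[of i n j "k + n - 2"] n by (simp only: cyc_eq_iff) simp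
    qed
    ultimately have "(\<Sum>j\<in>{j\<in>{1..n}. triple n j \<inter> triple n k \<noteq> {}}. measure_pmf.expectation P (\<lambda>b. X k b * X j b))
      = (\<Sum>i<5. measure_pmf.expectation P (\<lambda>b. X k b * X (k + n - 2 + i) b))"
      by (simp only: sum.reindex o_def Xcyc)
    also have "\<dots> = measure_pmf.expectation P (\<lambda>b. X k b * X (k + n - 2) b)
       + measure_pmf.expectation P (\<lambda>b. X k b * X (k + n - 1) b)
       + measure_pmf.expectation P (\<lambda>b. X k b * X k b)
       + measure_pmf.expectation P (\<lambda>b. X k b * X (k + 1) b)
       + measure_pmf.expectation P (\<lambda>b. X k b * X (k + 2) b)"
    proof -
      have "k + n - 2 + 0 = k + n - 2" "k + n - 2 + 1 = k + n - 1" "k + n - 2 + 2 = k + n"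
        "k + n - 2 + 3 = (k + 1) + n" "k + n - 2 + 4 = (k + 2) + n" using n by auto
      then show ?thesis unfolding sum_lessThan_5 by (simp only: Xn)
    qed
    also have "measure_pmf.expectation P (\<lambda>b. X k b * X (k + n - 2) b) = 8/243 - 16/729"
    proof -
      have "k + n - 2 + 2 = k + n" using n by auto
      then have "X (k + n - 2 + 2) = X k" using Xn by simp
      then show ?thesis using c2[of "k + n - 2"] by (simp add: mult.commute del: add_2_eq_Suc')
    qed
    also have "measure_pmf.expectation P (\<lambda>b. X k b * X (k + n - 1) b) = - 16/729"
    proof -
      have "k + n - 1 + 1 = k + n" using n by auto
      then have "X (k + n - 1 + 1) = X k" using Xn by simp
      then show ?thesis using c1[of "k + n - 1"] by (simp add: mult.commute)
    qed
    finally show ?thesis unfolding c0 c1 c2 by simp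
  qed
  have sumX: "(\<Sum>k\<in>{1..n}. X k b) = isolated n b - 4/27 * real n" for b
    by (simp add: X_def isolated_def sum_subtractf)
  \<comment> \<open>With 5 neighbours and at most 25 second neighbours the constant is
    \<open>25/2 + 250\<close>, which is rounded up to 263.\<close>
  have "norm (measure_pmf.expectation P (\<lambda>b. iexp (s * (\<Sum>k\<in>{1..n}. X k b))) - exp (- (76/729 * real n) * s\<^sup>2 / 2))
      \<le> real (card {1..n}) * ((real 5 ^ 2 / 2 + 2 * real 5 * real 25) * 1 ^ 3) * \<bar>s\<bar> ^ 3"
    unfolding P_def
  proof (rule char_local_dependence[where D = "triple n"])
    show "(\<Sum>k\<in>{1..n}. \<Sum>j\<in>{j\<in>{1..n}. triple n j \<inter> triple n k \<noteq> {}}.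
      measure_pmf.expectation (Pi_pmf {1..n} False (\<lambda>_. q)) (\<lambda>x. X k x * X j x)) = 76/729 * real n"
      unfolding P_def[symmetric] V by simp
    show "depends_on (X k) (triple n k)" for k
      unfolding X_def by (rule depends_on_comp[OF depends_on_iso])
    show "\<bar>X k x\<bar> \<le> 1" for k x using iso_bounds[of n k x] by (simp add: X_def abs_if)
    show "measure_pmf.expectation (Pi_pmf {1..n} False (\<lambda>_. q)) (X k) = 0" for k
      unfolding P_def[symmetric] X_def by (simp add: int E1)
  qed (use q triple_subset[of n] card_triple_meets[of n] card_triple_meets2[of n] n in auto)
  then have "norm (measure_pmf.expectation P (\<lambda>b. iexp (s * (isolated n b - 4/27 * real n))) - exp (- (76/729 * real n) * s\<^sup>2 / 2))
      \<le> real n * (525/2) * \<bar>s\<bar> ^ 3" unfolding sumX by simp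
  also have "\<dots> \<le> real n * 263 * \<bar>s\<bar> ^ 3" by (intro mult_right_mono mult_left_mono) auto
  finally show ?thesis unfolding P_def q_def .
qed

subsection \<open>Random permutations and exchangeable colourings\<close>

lemma set_random_perm: "set_pmf (random_perm n) = {\<sigma>. \<sigma> permutes {1..n}}"
proof -
  have "id \<in> {\<sigma>. \<sigma> permutes {1..n}}" by (simp add: permutes_id)
  then have "{\<sigma>. \<sigma> permutes {1..n}} \<noteq> {}" by blast
  then show ?thesis unfolding random_perm_def by (intro set_pmf_of_set finite_permutations finite_atLeastAtMost)
qed

lemma finite_random_perm: "finite (set_pmf (random_perm n))"
  by (simp add: set_random_perm finite_permutations)

lemma expectation_cong_support:
  fixes f g :: "'a \<Rightarrow> 'b::{banach, second_countable_topology}"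
  assumes "\<And>x. x \<in> set_pmf M \<Longrightarrow> f x = g x"
  shows "measure_pmf.expectation M f = measure_pmf.expectation M g"
  by (rule integral_cong_AE) (auto simp: AE_measure_pmf_iff assms)

lemma expectation_swap:
  fixes h :: "'a \<Rightarrow> 'b \<Rightarrow> 'c::{banach, second_countable_topology}"
  assumes "finite (set_pmf p)" "finite (set_pmf q)"
  shows "measure_pmf.expectation p (\<lambda>x. measure_pmf.expectation q (h x))
       = measure_pmf.expectation q (\<lambda>y. measure_pmf.expectation p (\<lambda>x. h x y))"
proof -
  have "measure_pmf.expectation (pair_pmf p q) (\<lambda>(x, y). h x y)
      = measure_pmf.expectation (pair_pmf q p) (\<lambda>(y, x). h x y)"
    by (subst pair_commute_pmf) (simp add: case_prod_unfold)
  then show ?thesis by (simp add: expectation_pair_pmf_finite assms)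
qed

lemma Pi_pmf_permute:
  fixes n :: nat
  assumes "\<sigma> permutes {1..n}"
  shows "map_pmf (\<lambda>c. c \<circ> inv \<sigma>) (Pi_pmf {1..n} d (\<lambda>_. q)) = Pi_pmf {1..n} d (\<lambda>_. q)"
proof -
  have p: "inv \<sigma> permutes {1..n}" by (rule permutes_inv[OF assms])
  show ?thesis
    by (rule Pi_pmf_bij_betw[OF finite_atLeastAtMost permutes_imp_bij[OF p], symmetric])
       (simp only: permutes_not_in[OF p] not_False_eq_True)
qed

text \<open>An iid colouring is exchangeable, so a further independent uniform shuffle of the
  positions does not change its law. This is how the random permutation enters.\<close>

lemma expectation_iid_permute:
  fixes h :: "(nat \<Rightarrow> 'a) \<Rightarrow> 'b::{banach, second_countable_topology}"
  assumes q: "finite (set_pmf q)"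
  shows "measure_pmf.expectation (Pi_pmf {1..n} d (\<lambda>_. q)) h
      = measure_pmf.expectation (Pi_pmf {1..n} d (\<lambda>_. q))
          (\<lambda>c. measure_pmf.expectation (random_perm n) (\<lambda>\<sigma>. h (c \<circ> inv \<sigma>)))"
proof -
  let ?P = "Pi_pmf {1..n} d (\<lambda>_. q)"
  have fin: "finite (set_pmf ?P)" by (rule finite_set_Pi_pmf) (use q in auto)
  have "measure_pmf.expectation ?P (\<lambda>c. measure_pmf.expectation (random_perm n) (\<lambda>\<sigma>. h (c \<circ> inv \<sigma>)))
      = measure_pmf.expectation (random_perm n) (\<lambda>\<sigma>. measure_pmf.expectation ?P (\<lambda>c. h (c \<circ> inv \<sigma>)))"
    by (rule expectation_swap[OF fin finite_random_perm])
  also have "\<dots> = measure_pmf.expectation (random_perm n) (\<lambda>\<sigma>. measure_pmf.expectation ?P h)"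
  proof (rule expectation_cong_support)
    fix \<sigma> assume "\<sigma> \<in> set_pmf (random_perm n)"
    then have "\<sigma> permutes {1..n}" by (simp add: set_random_perm)
    then have "measure_pmf.expectation ?P h = measure_pmf.expectation (map_pmf (\<lambda>c. c \<circ> inv \<sigma>) ?P) h"
      by (simp only: Pi_pmf_permute)
    then show "measure_pmf.expectation ?P (\<lambda>c. h (c \<circ> inv \<sigma>)) = measure_pmf.expectation ?P h" by simp
  qed
  finally show ?thesis by simp
qed

lemma map_random_perm_compose:
  assumes \<pi>: "\<pi> permutes {1..n}"
  shows "map_pmf (\<lambda>\<sigma>. \<sigma> \<circ> inv \<pi>) (random_perm n) = random_perm n"
  unfolding random_perm_def
proof (rule map_pmf_of_set_bij_betw)
  show "bij_betw (\<lambda>\<sigma>. \<sigma> \<circ> inv \<pi>) {\<sigma>. \<sigma> permutes {1..n}} {\<sigma>. \<sigma> permutes {1..n}}"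
  proof (rule bij_betw_byWitness[where f' = "\<lambda>\<sigma>. \<sigma> \<circ> \<pi>"])
    show "\<forall>\<sigma>\<in>{\<sigma>. \<sigma> permutes {1..n}}. (\<sigma> \<circ> inv \<pi>) \<circ> \<pi> = \<sigma>"
      using permutes_inv_o(2)[OF \<pi>] by (simp add: comp_assoc)
    show "\<forall>\<sigma>\<in>{\<sigma>. \<sigma> permutes {1..n}}. (\<sigma> \<circ> \<pi>) \<circ> inv \<pi> = \<sigma>"
      using permutes_inv_o(1)[OF \<pi>] by (simp add: comp_assoc)
  qed (use \<pi> permutes_inv[OF \<pi>] permutes_compose in auto)
  show "{\<sigma>. \<sigma> permutes {1..n}} \<noteq> {}" using \<pi> by auto
qed (simp add: finite_permutations)

text \<open>Colourings with the same colour counts differ by a permutation \<open>\<pi>\<close> of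
  the positions, and the uniform law absorbs \<open>\<pi>\<close>. After a shuffle only the counts
  matter.\<close>

lemma expectation_perm_cong_counts:
  fixes h :: "(nat \<Rightarrow> 'a) \<Rightarrow> 'b::{banach, second_countable_topology}"
  assumes h: "depends_on h {1..n}"
    and eq: "\<And>v. card {k\<in>{1..n}. c k = v} = card {k\<in>{1..n}. c' k = v}"
  shows "measure_pmf.expectation (random_perm n) (\<lambda>\<sigma>. h (c \<circ> inv \<sigma>))
       = measure_pmf.expectation (random_perm n) (\<lambda>\<sigma>. h (c' \<circ> inv \<sigma>))"
proof -
  have "image_mset c (mset_set {1..n}) = image_mset c' (mset_set {1..n})"
    by (rule multiset_eqI) (simp only: count_image_mset_eq_card_vimage[OF finite_atLeastAtMost] eq)
  from image_mset_eq_implies_permutes[OF finite_atLeastAtMost this]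
  obtain \<pi> where \<pi>: "\<pi> permutes {1..n}" and c: "\<forall>x\<in>{1..n}. c x = c' (\<pi> x)" by blast
  have "measure_pmf.expectation (random_perm n) (\<lambda>\<sigma>. h (c \<circ> inv \<sigma>))
      = measure_pmf.expectation (random_perm n) (\<lambda>\<sigma>. h (c' \<circ> inv (\<sigma> \<circ> inv \<pi>)))"
  proof (rule expectation_cong_support)
    fix \<sigma> assume "\<sigma> \<in> set_pmf (random_perm n)"
    then have \<sigma>: "\<sigma> permutes {1..n}" by (simp add: set_random_perm)
    have "inv (\<sigma> \<circ> inv \<pi>) = \<pi> \<circ> inv \<sigma>"
      using permutes_bij[OF \<sigma>] permutes_bij[OF permutes_inv[OF \<pi>]]
      by (simp add: o_inv_distrib permutes_inv_inv[OF \<pi>])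
    moreover have "inv \<sigma> k \<in> {1..n}" if "k \<in> {1..n}" for k
      using permutes_in_image[OF permutes_inv[OF \<sigma>]] that by blast
    ultimately show "h (c \<circ> inv \<sigma>) = h (c' \<circ> inv (\<sigma> \<circ> inv \<pi>))"
      using c by (intro depends_onD[OF h]) auto
  qed
  also have "\<dots> = measure_pmf.expectation (map_pmf (\<lambda>\<sigma>. \<sigma> \<circ> inv \<pi>) (random_perm n)) (\<lambda>\<sigma>. h (c' \<circ> inv \<sigma>))"
    by simp
  also have "\<dots> = measure_pmf.expectation (random_perm n) (\<lambda>\<sigma>. h (c' \<circ> inv \<sigma>))"
    unfolding map_random_perm_compose[OF \<pi>] ..
  finally show ?thesis .
qed

text \<open>Once shuffled, \<open>b\<close> may be replaced by the initial segment with the same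
  number \<open>N\<close> of ones; the shuffled segment is the configuration after \<open>N\<close>
  steps, with \<open>N\<close> independent of \<open>\<sigma>\<close>.\<close>

lemma expectation_iid_bool_perm:
  fixes h :: "(nat \<Rightarrow> bool) \<Rightarrow> 'b::{banach, second_countable_topology}"
  assumes h: "depends_on h {1..n}"
  shows "measure_pmf.expectation (Pi_pmf {1..n} d (\<lambda>_. q)) h
      = measure_pmf.expectation (Pi_pmf {1..n} d (\<lambda>_. q))
          (\<lambda>b. measure_pmf.expectation (random_perm n) (\<lambda>\<sigma>. h (\<lambda>k. inv \<sigma> k \<le> card {k\<in>{1..n}. b k})))"
proof -
  have q: "finite (set_pmf q)" by (rule finite_subset[OF subset_UNIV]) simp
  show ?thesis
    unfolding expectation_iid_permute[OF q, of n d h]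
  proof (rule expectation_cong_support)
    fix b
    define N where "N = card {k\<in>{1..n}. b k}"
    have "card {k\<in>{1..n}. b k} \<le> card {1..n}" by (rule card_mono) auto
    then have Nn: "N \<le> n" by (simp add: N_def)
    have T: "{k\<in>{1..n}. k \<le> N} = {1..N}" "{k\<in>{1..n}. \<not> k \<le> N} = {Suc N..n}" using Nn by auto
    have bF: "card {k\<in>{1..n}. \<not> b k} = n - N"
    proof -
      have "{k\<in>{1..n}. \<not> b k} = {1..n} - {k\<in>{1..n}. b k}" by auto
      moreover have "card ({1..n} - {k\<in>{1..n}. b k}) = card {1..n} - card {k\<in>{1..n}. b k}"
        by (rule card_Diff_subset) auto
      ultimately show ?thesis by (simp add: N_def)
    qed
    have "card {k\<in>{1..n}. b k = v} = card {k\<in>{1..n}. (k \<le> N) = v}" for v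
    proof (cases v)
      case True
      then show ?thesis by (simp add: T(1) N_def[symmetric] del: atLeastAtMost_iff One_nat_def)
    next
      case False
      then show ?thesis using T(2) bF by simp
    qed
    from expectation_perm_cong_counts[OF h this]
    show "measure_pmf.expectation (random_perm n) (\<lambda>\<sigma>. h (b \<circ> inv \<sigma>))
       = measure_pmf.expectation (random_perm n) (\<lambda>\<sigma>. h (\<lambda>k. inv \<sigma> k \<le> card {k\<in>{1..n}. b k}))"
      by (simp add: comp_def N_def)
  qed
qed

section \<open>Stirling bounds and the transfer from three iid colours to permutations\<close>

lemma power_le_fact_mult_exp:
  fixes y :: real assumes "0 \<le> y" shows "y ^ p \<le> fact p * exp y"
proof -
  have s: "summable (\<lambda>k. y ^ k /\<^sub>R fact k)" by (rule summable_exp_generic)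
  have "(\<Sum>k\<in>{p}. y ^ k /\<^sub>R fact k) \<le> exp y"
    unfolding exp_def by (rule sum_le_suminf[OF s]) (use assms in auto)
  then show ?thesis by (simp add: field_simps)
qed

lemma power_self_le: "real n ^ n \<le> exp (real n) * fact n"
  using power_le_fact_mult_exp[of "real n" n] by (simp add: mult.commute)

text \<open>Stirling's upper bound with a spare polynomial factor. The induction rests on
  \<open>(k / (k + 1)) ^ (k + 1) \<le> exp (- 1)\<close>; writing \<open>k + 1\<close> instead of
  \<open>k\<close> in the factor covers \<open>k = 0\<close>.\<close>

lemma fact_le_power_self: "fact k \<le> exp 1 * (real k + 1) * real k ^ k * exp (- real k)"
proof (cases k)
  case 0
  then show ?thesis by simp
next
  case (Suc l)
  have "fact (Suc l) \<le> real (Suc l) ^ (Suc l + 1) * exp (1 - real (Suc l))" for l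
  proof (induction l)
    case 0
    then show ?case by simp
  next
    case (Suc l)
    define k where "k = Suc l"
    have "real k / real (k + 1) = 1 + (- (1 / real (k + 1)))" by (simp add: field_simps)
    also have "\<dots> \<le> exp (- (1 / real (k + 1)))" by (rule exp_ge_add_one_self)
    finally have "(real k / real (k + 1)) ^ (k + 1) \<le> exp (- (1 / real (k + 1))) ^ (k + 1)"
      by (intro power_mono) auto
    also have "\<dots> = exp (- 1)"
      unfolding exp_of_nat_mult[symmetric] by (simp add: field_simps)
    finally have le: "real k ^ (k + 1) \<le> real (k + 1) ^ (k + 1) * exp (- 1)"
      by (simp only: power_divide pos_divide_le_eq zero_less_power of_nat_0_less_iff add_gr_0
          zero_less_one simp_thms mult.commute)
    have "fact (Suc k) = real (k + 1) * fact k" by simp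
    also have "\<dots> \<le> real (k + 1) * (real k ^ (k + 1) * exp (1 - real k))"
      using Suc.IH by (intro mult_left_mono) (auto simp: k_def)
    also have "\<dots> \<le> real (k + 1) * ((real (k + 1) ^ (k + 1) * exp (- 1)) * exp (1 - real k))"
      by (intro mult_left_mono mult_right_mono le) auto
    also have "\<dots> = real (Suc k) ^ (Suc k + 1) * exp (1 - real (Suc k))"
      by (simp add: mult_ac flip: exp_add)
    finally show ?case unfolding k_def .
  qed
  from this[of l] have "fact k \<le> real k ^ (k + 1) * exp (1 - real k)" using Suc by simp
  also have "\<dots> = exp 1 * real k * real k ^ k * exp (- real k)" by (simp add: exp_diff exp_minus field_simps)
  also have "\<dots> \<le> exp 1 * (real k + 1) * real k ^ k * exp (- real k)"
    by (intro mult_right_mono mult_left_mono) auto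
  finally show ?thesis .
qed

text \<open>A multinomial vector with cell probabilities \<open>a / n\<close>, \<open>b / n\<close>,
  \<open>c / n\<close> equals \<open>(a, b, c)\<close> with probability at least
  \<open>1 / (exp 3 * (n + 1) ^ 3)\<close>. Each of the three factorials contributes
  \<open>exp 1 * (n + 1)\<close>; the exponentials cancel since
  \<open>a + b + c = n\<close>.\<close>

lemma multinomial_mode_bound:
  assumes n: "n = a + b + c"
  shows "real n ^ n \<le> exp 3 * (real n + 1) ^ 3 *
     (real (n choose a) * real ((n - a) choose b) * (real a ^ a * real b ^ b * real c ^ c))"
proof -
  define X where "X = real (n choose a) * real ((n - a) choose b)"
  define F :: real where "F = fact a * fact b * fact c"
  have F: "F > 0" by (simp add: F_def)
  have XF: "X * F = fact n" using n by (simp add: X_def F_def binomial_fact field_simps)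
  have "real n ^ n * F
      \<le> exp 3 * (real n + 1) ^ 3 * (fact n * (real a ^ a * real b ^ b * real c ^ c))"
  proof -
    have f: "fact k \<le> exp 1 * (real n + 1) * real k ^ k * exp (- real k)" if "k \<le> n" for k
      by (rule order_trans[OF fact_le_power_self]) (use that in \<open>intro mult_right_mono mult_left_mono, auto\<close>)
    have "real n ^ n * (fact a * fact b * fact c)
      \<le> (exp (real n) * fact n) * ((exp 1 * (real n + 1) * real a ^ a * exp (- real a))
         * (exp 1 * (real n + 1) * real b ^ b * exp (- real b))
         * (exp 1 * (real n + 1) * real c ^ c * exp (- real c)))"
      by (intro mult_mono power_self_le f) (use n in auto)
    also have "\<dots> = (exp (real n) * exp (- real a) * exp (- real b) * exp (- real c)) * (exp 1 * exp 1 * exp 1)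
       * (real n + 1) ^ 3 * (fact n * (real a ^ a * real b ^ b * real c ^ c))"
      by (simp only: power3_eq_cube mult_ac)
    also have "exp (real n) * exp (- real a) * exp (- real b) * exp (- real c) = 1"
      using n by (simp flip: exp_add)
    also have "exp 1 * exp 1 * exp 1 = (exp 3 :: real)" by (simp flip: exp_add)
    finally show ?thesis by (simp add: F_def)
  qed
  also have "\<dots> = (exp 3 * (real n + 1) ^ 3 * (X * (real a ^ a * real b ^ b * real c ^ c))) * F"
    by (simp only: XF[symmetric] mult_ac)
  finally show ?thesis using F by (simp add: X_def)
qed

text \<open>The colours record when a position becomes a one: by time \<open>m\<close>, between the
  two times, or later. The configuration at time \<open>m\<close> is the set of colours at most 0,
  that at time \<open>m'\<close> the set of colours at most 1.\<close>

definition phase :: "nat \<Rightarrow> nat \<Rightarrow> nat \<Rightarrow> nat" where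
  "phase m m' u = (if u \<le> m then 0 else if u \<le> m' then 1 else 2)"

text \<open>The colour of a uniform time, so the colour probabilities are exactly the true counts
  divided by \<open>n\<close>, as the multinomial bound requires.\<close>

definition phase_pmf :: "nat \<Rightarrow> nat \<Rightarrow> nat \<Rightarrow> nat pmf" where
  "phase_pmf n m m' = map_pmf (phase m m') (pmf_of_set {1..n})"

lemma finite_phase_pmf: "n > 0 \<Longrightarrow> finite (set_pmf (phase_pmf n m m'))"
  unfolding phase_pmf_def by simp

lemma measure_phase_pmf:
  assumes "n > 0"
  shows "measure (phase_pmf n m m') V = real (card {u\<in>{1..n}. phase m m' u \<in> V}) / real n"
proof -
  have "{1..n} \<inter> phase m m' -` V = {u\<in>{1..n}. phase m m' u \<in> V}" by auto
  then show ?thesis using assms unfolding phase_pmf_def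
    by (simp add: measure_map_pmf measure_pmf_of_set)
qed

lemma phase_levels:
  assumes "m \<le> m'" "m' \<le> n"
  shows "card {k\<in>{1..n}. phase m m' k = 0} = m"
    "card {k\<in>{1..n}. phase m m' k = 1} = m' - m"
    "card {k\<in>{1..n}. phase m m' k = 2} = n - m'"
proof -
  have "{k\<in>{1..n}. phase m m' k = 0} = {1..m}" "{k\<in>{1..n}. phase m m' k = 1} = {Suc m..m'}"
    "{k\<in>{1..n}. phase m m' k = 2} = {Suc m'..n}"
    using assms by (auto simp: phase_def)
  then show "card {k\<in>{1..n}. phase m m' k = 0} = m"
    "card {k\<in>{1..n}. phase m m' k = 1} = m' - m"
    "card {k\<in>{1..n}. phase m m' k = 2} = n - m'" by simp_all
qed

lemma pmf_phase_pmf: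
  assumes "n > 0" "m \<le> m'" "m' \<le> n"
  shows "pmf (phase_pmf n m m') 0 = real m / real n" "pmf (phase_pmf n m m') 1 = real (m' - m) / real n"
    "pmf (phase_pmf n m m') 2 = real (n - m') / real n"
  using phase_levels[OF assms(2,3)] measure_phase_pmf[OF assms(1), of m m' "{_}"]
  by (simp_all only: measure_pmf_single singleton_iff)

text \<open>The iid expectation of \<open>h\<close> is that of the shuffle average \<open>g\<close>.
  As \<open>h\<close> is nonnegative, it can be restricted to the colourings with the exact counts
  of \<open>phase m m'\<close>; there \<open>g\<close> is constant and equal to the permutation
  expectation, and the probability of this event is at least the multinomial bound.\<close>

lemma expectation_perm_phase_le:
  fixes h :: "(nat \<Rightarrow> nat) \<Rightarrow> real"
  assumes n: "n > 0" and m: "m \<le> m'" "m' \<le> n"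
    and dep: "depends_on h {1..n}" and h0: "\<And>c. 0 \<le> h c"
  shows "measure_pmf.expectation (random_perm n) (\<lambda>\<sigma>. h (phase m m' \<circ> inv \<sigma>))
     \<le> exp 3 * (real n + 1) ^ 3 * measure_pmf.expectation (Pi_pmf {1..n} 2 (\<lambda>_. phase_pmf n m m')) h"
proof -
  define P where "P = Pi_pmf {1..n} 2 (\<lambda>_. phase_pmf n m m')"
  have q: "finite (set_pmf (phase_pmf n m m'))" using finite_phase_pmf[OF n] .
  have fin: "finite (set_pmf P)" unfolding P_def by (rule finite_set_Pi_pmf) (use q in auto)
  define g where "g c = measure_pmf.expectation (random_perm n) (\<lambda>\<sigma>. h (c \<circ> inv \<sigma>))" for c
  have g0: "0 \<le> g c" for c unfolding g_def by (intro Bochner_Integration.integral_nonneg h0)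
  \<comment> \<open>The colourings with the right counts are indexed by their level sets
    \<open>A\<close> for colour 0 and \<open>B\<close> for colour 1, which makes their number a
    product of two binomial coefficients.\<close>
  define J where "J = (SIGMA A:{A. A \<subseteq> {1..n} \<and> card A = m}. {B. B \<subseteq> {1..n} - A \<and> card B = m' - m})"
  define \<phi> :: "nat set \<times> nat set \<Rightarrow> nat \<Rightarrow> nat"
    where "\<phi> = (\<lambda>(A, B) k. if k \<in> A then 0 else if k \<in> B then 1 else 2)"
  define w where "w = real m ^ m * real (m' - m) ^ (m' - m) * real (n - m') ^ (n - m')"
  have finJ: "finite J" unfolding J_def by (intro finite_SigmaI) auto
  have cardJ: "card J = (n choose m) * ((n - m) choose (m' - m))"
  proof -
    have "card J = (\<Sum>A | A \<subseteq> {1..n} \<and> card A = m. card {B. B \<subseteq> {1..n} - A \<and> card B = m' - m})"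
      unfolding J_def by (rule card_SigmaI) auto
    also have "\<dots> = (\<Sum>A | A \<subseteq> {1..n} \<and> card A = m. (n - m) choose (m' - m))"
    proof (rule sum.cong[OF refl])
      fix A assume "A \<in> {A. A \<subseteq> {1..n} \<and> card A = m}"
      then have A: "A \<subseteq> {1..n}" "card A = m" by auto
      then have "card ({1..n} - A) = n - m"
        using card_Diff_subset[OF finite_subset[OF A(1) finite_atLeastAtMost] A(1)] by simp
      then show "card {B. B \<subseteq> {1..n} - A \<and> card B = m' - m} = (n - m) choose (m' - m)"
        using n_subsets[of "{1..n} - A" "m' - m"] by simp
    qed
    also have "\<dots> = (n choose m) * ((n - m) choose (m' - m))"
      using n_subsets[of "{1..n}" m] by simp
    finally show ?thesis .
  qed
  have inj: "inj_on \<phi> J"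
  proof (rule inj_onI)
    fix x y assume x: "x \<in> J" "y \<in> J" and eq: "\<phi> x = \<phi> y"
    have "fst z = {k. \<phi> z k = 0} \<and> snd z = {k. \<phi> z k = 1}" if "z \<in> J" for z
    proof -
      obtain A B where z: "z = (A, B)" by (cases z)
      then have "A \<inter> B = {}" using that by (auto simp: J_def)
      then show ?thesis unfolding z \<phi>_def by auto
    qed
    then show "x = y" using x eq by (metis prod.collapse)
  qed
  have point: "pmf P c * g c = w / real n ^ n * g (phase m m')" if cJ: "c \<in> \<phi> ` J" for c
  proof -
    obtain A B where J: "(A, B) \<in> J" and c: "c = \<phi> (A, B)" using cJ by (metis imageE surj_pair)
    have AB: "A \<subseteq> {1..n}" "card A = m" "B \<subseteq> {1..n} - A" "card B = m' - m"
      using J unfolding J_def mem_Sigma_iff mem_Collect_eq by simp_all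
    define R where "R = {1..n} - A - B"
    have finAB: "finite A" "finite B" "finite R"
      using AB by (auto simp: R_def intro: finite_subset)
    have cR: "card R = n - m'"
    proof -
      have "card ({1..n} - A) = n - m" using AB finAB by (subst card_Diff_subset) auto
      moreover have "card R = card ({1..n} - A) - card B"
        unfolding R_def using AB finAB by (subst card_Diff_subset) auto
      ultimately show ?thesis using AB m by simp
    qed
    have cA: "k \<in> A \<Longrightarrow> c k = 0" and cB: "k \<in> B \<Longrightarrow> c k = 1" and cRv: "k \<in> R \<Longrightarrow> c k = 2" for k
      using AB by (auto simp: c \<phi>_def R_def)
    have split: "{1..n} = A \<union> (B \<union> R)" "A \<inter> (B \<union> R) = {}" "B \<inter> R = {}"
      using AB by (auto simp: R_def)
    \<comment> \<open>Outside \<open>{1..n}\<close> the colouring \<open>\<phi> (A, B)\<close> takes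
      the value 2, which agrees with the default of the product measure.\<close>
    have "pmf P c = (\<Prod>k\<in>{1..n}. pmf (phase_pmf n m m') (c k))"
      unfolding P_def by (rule pmf_Pi') (use AB in \<open>auto simp: c \<phi>_def\<close>)
    also have "\<dots> = (\<Prod>k\<in>A. pmf (phase_pmf n m m') (c k)) * ((\<Prod>k\<in>B. pmf (phase_pmf n m m') (c k))
        * (\<Prod>k\<in>R. pmf (phase_pmf n m m') (c k)))"
      unfolding split(1) using finAB split by (simp add: prod.union_disjoint)
    also have "\<dots> = (real m / real n) ^ m * ((real (m' - m) / real n) ^ (m' - m) * (real (n - m') / real n) ^ (n - m'))"
      using AB cR by (simp add: cA cB cRv pmf_phase_pmf[OF n m, unfolded One_nat_def])
    also have "\<dots> = w / (real n ^ m * (real n ^ (m' - m) * real n ^ (n - m')))"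
      by (simp add: w_def power_divide)
    also have "real n ^ m * (real n ^ (m' - m) * real n ^ (n - m')) = real n ^ n"
      using m by (simp flip: power_add)
    finally have p: "pmf P c = w / real n ^ n" .
    have "card {k\<in>{1..n}. c k = v} = card {k\<in>{1..n}. phase m m' k = v}" for v
    proof -
      have "{k\<in>{1..n}. c k = v} = (if v = 0 then A else if v = 1 then B else if v = 2 then R else {})"
        using AB by (auto simp: c \<phi>_def R_def split: if_splits)
      moreover have "{k\<in>{1..n}. phase m m' k = v} = {}" if "v \<noteq> 0" "v \<noteq> 1" "v \<noteq> 2"
        using that by (auto simp: phase_def)
      ultimately show ?thesis using phase_levels[OF m] AB cR by auto
    qed
    from expectation_perm_cong_counts[OF dep this] show ?thesis unfolding p g_def by simp
  qed
  have "real (card J) * (w / real n ^ n * g (phase m m')) = (\<Sum>c\<in>\<phi> ` J. pmf P c * g c)"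
    using card_image[OF inj] by (simp add: point)
  also have "\<dots> = measure_pmf.expectation P (\<lambda>c. indicator (\<phi> ` J) c * g c)"
    by (subst integral_measure_pmf_real[of "\<phi> ` J"]) (use finJ in \<open>auto simp: indicator_def mult_ac intro!: sum.cong split: if_splits\<close>)
  also have "\<dots> \<le> measure_pmf.expectation P g"
    by (intro integral_mono integrable_measure_pmf_finite fin) (auto simp: indicator_def g0)
  also have "\<dots> = measure_pmf.expectation P h"
    unfolding P_def g_def by (rule expectation_iid_permute[OF q, symmetric])
  finally have le: "real (card J) * (w / real n ^ n * g (phase m m')) \<le> measure_pmf.expectation P h" .
  have "real n ^ n \<le> exp 3 * (real n + 1) ^ 3 * (real (card J) * w)"
    unfolding cardJ w_def of_nat_mult by (rule multinomial_mode_bound) (use m in simp)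
  then have "1 \<le> exp 3 * (real n + 1) ^ 3 * (real (card J) * w) / real n ^ n"
    using n by simp
  then have "1 * g (phase m m') \<le> exp 3 * (real n + 1) ^ 3 * (real (card J) * w) / real n ^ n * g (phase m m')"
    by (rule mult_right_mono) (rule g0)
  also have "\<dots> = exp 3 * (real n + 1) ^ 3 * (real (card J) * (w / real n ^ n * g (phase m m')))"
    by simp
  also have "\<dots> \<le> exp 3 * (real n + 1) ^ 3 * measure_pmf.expectation P h"
    by (intro mult_left_mono le) auto
  finally show ?thesis unfolding g_def P_def by simp
qed

section \<open>Exponential moments of increments and of counts\<close>

definition iso_rate :: "real \<Rightarrow> real" where
  "iso_rate p = p * (1 - p)\<^sup>2"

text \<open>In the three-colouring the increment is a local sum of terms \<open>h k\<close> with
  exactly the stated mean. A term is nonzero only if its window contains the colour 1, so its second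
  moment is at most \<open>3 * (m' - m) / n\<close>, and \<open>n\<close> such terms yield the scale
  under the root; the summand 1 there keeps the scale at least 1.\<close>

lemma isolated_increment_moment:
  assumes n: "n \<ge> 3" and m: "m \<le> m'" "m' \<le> n"
  shows "measure_pmf.expectation (random_perm n) (\<lambda>\<sigma>.
      exp (\<bar>X1 n m' \<sigma> - X1 n m \<sigma> - real n * (iso_rate (real m' / real n) - iso_rate (real m / real n))\<bar>
        / (12 * sqrt (3 * (real m' - real m) + 1))))
    \<le> 3 * exp 3 * (real n + 1) ^ 3"
proof -
  have n0: "n > 0" using n by simp
  define q where "q = phase_pmf n m m'"
  define P where "P = Pi_pmf {1..n} 2 (\<lambda>_. q)"
  have q: "finite (set_pmf q)" unfolding q_def using finite_phase_pmf[OF n0] .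
  have fin: "finite (set_pmf P)" unfolding P_def by (rule finite_set_Pi_pmf) (use q in auto)
  note int = integrable_measure_pmf_finite[OF fin, where 'b = real]
  define h where "h k c = iso n k (\<lambda>i. c i \<le> 1) - iso n k (\<lambda>i. c i \<le> 0)" for k and c :: "nat \<Rightarrow> nat"
  define s where "s = sqrt (3 * (real m' - real m) + 1)"
  define M where "M = real n * (iso_rate (real m' / real n) - iso_rate (real m / real n))"
  define H where "H c = exp (\<bar>(\<Sum>k = 1..n. h k c) - M\<bar> / (12 * s))" for c
  have m0: "measure q {x. x \<le> 0} = real m / real n"
  proof -
    have "{u\<in>{1..n}. phase m m' u \<in> {x. x \<le> 0}} = {1..m}" using m by (auto simp: phase_def)
    then show ?thesis unfolding q_def measure_phase_pmf[OF n0] by simp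
  qed
  have m1: "measure q {x. x \<le> 1} = real m' / real n"
  proof -
    have "{u\<in>{1..n}. phase m m' u \<in> {x. x \<le> 1}} = {1..m'}" using m by (auto simp: phase_def)
    then show ?thesis unfolding q_def measure_phase_pmf[OF n0] by simp
  qed
  have e1: "measure q {x. x = 1} = real (m' - m) / real n"
    using pmf_phase_pmf(2)[OF n0 m] by (simp add: q_def measure_pmf_single)
  have Eh: "measure_pmf.expectation P (h k) = iso_rate (real m' / real n) - iso_rate (real m / real n)" for k
  proof -
    have "measure_pmf.expectation P (h k) = measure_pmf.expectation P (\<lambda>c. iso n k (\<lambda>i. c i \<le> 1))
       - measure_pmf.expectation P (\<lambda>c. iso n k (\<lambda>i. c i \<le> 0))"
      unfolding h_def by (rule Bochner_Integration.integral_diff) (rule int)+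
    then show ?thesis
      using expectation_iso[where B = "\<lambda>x. x \<le> 1" and q = q and d = 2 and n = n and k = k, OF q n]
        expectation_iso[where B = "\<lambda>x. x \<le> 0" and q = q and d = 2 and n = n and k = k, OF q n]
      by (simp only: P_def m0 m1 iso_rate_def)
  qed
  have Eh2: "measure_pmf.expectation P (\<lambda>c. (h k c)\<^sup>2) \<le> 3 * (real m' - real m) / real n" for k
  proof -
    have single: "measure_pmf.expectation P (\<lambda>c. of_bool (c (cyc n j) = 1)) = (real m' - real m) / real n" for j
      using expectation_cylinder[OF q, where l = 1 and n = n and d = 2 and B = "\<lambda>x. x = 1" and w = "\<lambda>_. True" and k = j] n m e1
      by (simp add: P_def lessThan_Suc of_nat_diff)
    have "(h k c)\<^sup>2 \<le> of_bool (c (cyc n k) = 1) + of_bool (c (cyc n (k + 1)) = 1) + of_bool (c (cyc n (k + 2)) = 1)" for c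
    proof (cases "c (cyc n k) = 1 \<or> c (cyc n (k + 1)) = 1 \<or> c (cyc n (k + 2)) = 1")
      case True
      have "(h k c)\<^sup>2 \<le> 1" unfolding h_def iso_def by simp
      then show ?thesis using True by (auto simp: add_increasing add_increasing2 simp del: One_nat_def add_2_eq_Suc')
    next
      case False
      then have "x \<le> 1 \<longleftrightarrow> x \<le> 0" if "x \<in> {c (cyc n k), c (cyc n (k + 1)), c (cyc n (k + 2))}" for x :: nat
        using that by (auto simp: le_Suc_eq)
      then show ?thesis by (simp add: h_def iso_def)
    qed
    then have "measure_pmf.expectation P (\<lambda>c. (h k c)\<^sup>2) \<le> measure_pmf.expectation P
      (\<lambda>c. of_bool (c (cyc n k) = 1) + of_bool (c (cyc n (k + 1)) = 1) + of_bool (c (cyc n (k + 2)) = 1))"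
      by (intro integral_mono int) auto
    also have "\<dots> = measure_pmf.expectation P (\<lambda>c. of_bool (c (cyc n k) = 1))
       + measure_pmf.expectation P (\<lambda>c. of_bool (c (cyc n (k + 1)) = 1))
       + measure_pmf.expectation P (\<lambda>c. of_bool (c (cyc n (k + 2)) = 1))"
      by (simp add: int)
    also have "\<dots> = 3 * (real m' - real m) / real n" unfolding single by (simp add: diff_divide_distrib)
    finally show ?thesis .
  qed
  have s2: "s\<^sup>2 = 3 * (real m' - real m) + 1" "1 \<le> s" using m by (auto simp: s_def)
  have "measure_pmf.expectation P H \<le> 3"
  proof -
    have "measure_pmf.expectation P (\<lambda>x. exp (\<bar>(\<Sum>k = 1..n. h k x) - (\<Sum>k = 1..n. measure_pmf.expectation P (h k))\<bar> / (12 * s))) \<le> 3"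
      unfolding P_def
    proof (rule exp_abs_moment_cyclic[OF n0 q])
      show "depends_on (h k) (triple n k)" for k
        unfolding h_def by (rule depends_on_comp2[OF depends_on_iso_comp depends_on_iso_comp])
      show "\<bar>h k x\<bar> \<le> 1" for k x unfolding h_def iso_def by simp
      show "measure_pmf.expectation (Pi_pmf {1..n} 2 (\<lambda>_. q)) (\<lambda>x. (h k x)\<^sup>2) \<le> 3 * (real m' - real m) / real n" for k
        using Eh2[of k] by (simp only: P_def)
    qed (use n0 s2 in auto)
    then show ?thesis unfolding H_def M_def Eh by simp
  qed
  moreover have "measure_pmf.expectation (random_perm n) (\<lambda>\<sigma>. H (phase m m' \<circ> inv \<sigma>))
     \<le> exp 3 * (real n + 1) ^ 3 * measure_pmf.expectation P H"
    unfolding P_def q_def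
  proof (rule expectation_perm_phase_le[OF n0 m])
    have "depends_on (\<lambda>c. \<Sum>k = 1..n. h k c) {1..n}"
      unfolding h_def
      by (intro depends_on_sum depends_on_comp2[where h = "\<lambda>x y. x - y"]
          depends_on_mono[OF depends_on_iso_comp triple_subset[OF n0]])
    then show "depends_on H {1..n}" unfolding H_def by (rule depends_on_comp)
  qed (simp add: H_def)
  moreover have "(\<Sum>k = 1..n. h k (phase m m' \<circ> inv \<sigma>)) = X1 n m' \<sigma> - X1 n m \<sigma>" for \<sigma>
  proof -
    have "phase m m' u \<le> 1 \<longleftrightarrow> u \<le> m'" "phase m m' u \<le> 0 \<longleftrightarrow> u \<le> m" for u
      using m by (auto simp: phase_def)
    then show ?thesis
      by (simp only: h_def X1_eq_isolated isolated_def sum_subtractf comp_def)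
  qed
  ultimately have "measure_pmf.expectation (random_perm n) (\<lambda>\<sigma>. exp (\<bar>X1 n m' \<sigma> - X1 n m \<sigma> - M\<bar> / (12 * s)))
    \<le> exp 3 * (real n + 1) ^ 3 * measure_pmf.expectation P H"
    by (simp add: H_def)
  also have "\<dots> \<le> exp 3 * (real n + 1) ^ 3 * 3"
    using \<open>measure_pmf.expectation P H \<le> 3\<close> by (intro mult_left_mono) auto
  finally show ?thesis by (simp add: M_def s_def mult_ac)
qed

text \<open>The number of ones is treated as one more local sum on the cycle, whose terms read a
  single position of their window.\<close>

lemma bernoulli_count_moment:
  assumes n: "n > 0"
  shows "measure_pmf.expectation (Pi_pmf {1..n} False (\<lambda>_. bernoulli_pmf (1/3)))
      (\<lambda>b. exp (\<bar>real (card {k\<in>{1..n}. b k}) - real n / 3\<bar> / (12 * sqrt (real n)))) \<le> 3"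
proof -
  define q where "q = bernoulli_pmf (1/3)"
  define P where "P = Pi_pmf {1..n} False (\<lambda>_. q)"
  have q: "finite (set_pmf q)" unfolding q_def by (rule finite_subset[OF subset_UNIV]) simp
  have m: "measure q {x. x} = 1/3" unfolding q_def by (rule measure_bernoulli_True) auto
  define h :: "nat \<Rightarrow> (nat \<Rightarrow> bool) \<Rightarrow> real" where "h k b = of_bool (b (cyc n k))" for k b
  have Eh: "measure_pmf.expectation P (h k) = 1/3" for k
    using expectation_cylinder[OF q, where l = 1 and n = n and d = False and B = "\<lambda>x. x" and w = "\<lambda>_. True" and k = k] n m
    by (simp add: P_def h_def[abs_def] lessThan_Suc)
  have sum: "(\<Sum>k = 1..n. h k b) = real (card {k\<in>{1..n}. b k})" for b
  proof -
    have "(\<Sum>k = 1..n. h k b) = (\<Sum>k\<in>{1..n}. of_bool (b k))"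
      unfolding h_def by (intro sum.cong refl) (simp only: cyc_id)
    also have "\<dots> = real (card {k\<in>{1..n}. b k})" by (simp add: sum_of_bool_eq Int_def)
    finally show ?thesis .
  qed
  have "measure_pmf.expectation P (\<lambda>x. exp (\<bar>(\<Sum>k = 1..n. h k x) - (\<Sum>k = 1..n. measure_pmf.expectation P (h k))\<bar> / (12 * sqrt (real n)))) \<le> 3"
    unfolding P_def
  proof (rule exp_abs_moment_cyclic[where v = 1, OF n q])
    show "depends_on (h k) (triple n k)" for k
      by (auto simp: depends_on_def h_def triple_def)
    show "\<bar>h k x\<bar> \<le> 1" for k x by (simp add: h_def)
    have "(h k x)\<^sup>2 = h k x" for k x by (simp add: h_def)
    then show "measure_pmf.expectation (Pi_pmf {1..n} False (\<lambda>_. q)) (\<lambda>x. (h k x)\<^sup>2) \<le> 1" for k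
      using Eh[of k] by (simp add: P_def)
  qed (use n in auto)
  then show ?thesis unfolding Eh sum unfolding P_def q_def by simp
qed

lemma bernoulli_isolated_moment:
  assumes n: "n \<ge> 3"
  shows "measure_pmf.expectation (Pi_pmf {1..n} False (\<lambda>_. bernoulli_pmf (1/3)))
      (\<lambda>b. exp (\<bar>isolated n b - 4/27 * real n\<bar> / (12 * sqrt (real n)))) \<le> 3"
proof -
  define q where "q = bernoulli_pmf (1/3)"
  define P where "P = Pi_pmf {1..n} False (\<lambda>_. q)"
  have n0: "n > 0" using n by simp
  have q: "finite (set_pmf q)" unfolding q_def by (rule finite_subset[OF subset_UNIV]) simp
  have m: "measure q {x. x} = 1/3" unfolding q_def by (rule measure_bernoulli_True) auto
  have Eh: "measure_pmf.expectation P (iso n k) = 4/27" for k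
    using expectation_iso[where B = "\<lambda>x. x" and q = q and d = False and n = n and k = k, OF q] n
    by (simp add: P_def m power2_eq_square)
  have "measure_pmf.expectation P (\<lambda>x. exp (\<bar>(\<Sum>k = 1..n. iso n k x) - (\<Sum>k = 1..n. measure_pmf.expectation P (iso n k))\<bar> / (12 * sqrt (real n)))) \<le> 3"
    unfolding P_def
  proof (rule exp_abs_moment_cyclic[where v = 1, OF n0 q depends_on_iso])
    show "\<bar>iso n k x\<bar> \<le> 1" for k x by (simp add: iso_def)
    have "(iso n k x)\<^sup>2 = iso n k x" for k x by (simp add: iso_def)
    then show "measure_pmf.expectation (Pi_pmf {1..n} False (\<lambda>_. q)) (\<lambda>x. (iso n k x)\<^sup>2) \<le> 1" for k
      using Eh[of k] by (simp add: P_def)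
  qed (use n in auto)
  then show ?thesis unfolding Eh unfolding P_def q_def by (simp add: isolated_def mult.commute)
qed

subsection \<open>The maximum over all times\<close>

text \<open>A double zero at \<open>1/3\<close> times a factor that lies between \<open>1/3\<close>
  and \<open>4/3\<close> on the unit interval: this yields the lower bound for the loss at the
  maximising time as well as the upper bound at \<open>N\<close>.\<close>

lemma iso_rate_third: "iso_rate (1/3) - iso_rate t = (t - 1/3)\<^sup>2 * (4/3 - t)"
  unfolding iso_rate_def by (simp add: power2_eq_square field_simps)

lemma X1_bounds: "0 \<le> X1 n m \<sigma>" "X1 n m \<sigma> \<le> real n"
  unfolding X1_eq_isolated by (rule isolated_bounds)+

lemma X1_max_attained: "\<exists>m\<le>n. X1_max n \<sigma> = X1 n m \<sigma>"
proof -
  have "X1_max n \<sigma> \<in> (\<lambda>m. X1 n m \<sigma>) ` {0..n}" unfolding X1_max_def by (rule Max_in) auto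
  then show ?thesis by auto
qed

lemma X1_le_max: "m \<le> n \<Longrightarrow> X1 n m \<sigma> \<le> X1_max n \<sigma>"
  unfolding X1_max_def by (intro Max_ge) auto

definition regular_increments :: "real \<Rightarrow> nat \<Rightarrow> (nat \<Rightarrow> nat) \<Rightarrow> bool" where
  "regular_increments \<beta> n \<sigma> \<longleftrightarrow> (\<forall>m m'. m \<le> m' \<longrightarrow> m' \<le> n \<longrightarrow>
     \<bar>X1 n m' \<sigma> - X1 n m \<sigma> - real n * (iso_rate (real m' / real n) - iso_rate (real m / real n))\<bar>
       \<le> \<beta> * sqrt (3 * (real m' - real m) + 1))"

text \<open>The quadratic loss \<open>e\<^sup>2 / (3 n)\<close> of the mean at distance \<open>e\<close> from the maximiser
  \<open>n / 3\<close> beats the fluctuation \<open>\<beta> \<surd>e\<close> of the increments as soon as \<open>e > n powr (3/4)\<close>; closer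
  to \<open>n / 3\<close> the fluctuation is at most of order \<open>n powr (7/16)\<close>.\<close>

lemma X1_max_near_third:
  assumes reg: "regular_increments \<beta> n \<sigma>" and N: "N \<le> n" "\<bar>real N - real n / 3\<bar> \<le> \<beta> ^ 9"
    and \<beta>: "real n = \<beta> ^ 16" "\<beta> \<ge> 6"
  shows "\<bar>X1_max n \<sigma> - X1 n N \<sigma>\<bar> \<le> 3 * \<beta> ^ 7"
proof -
  obtain m where m: "m \<le> n" "X1_max n \<sigma> = X1 n m \<sigma>" using X1_max_attained by blast
  have n: "real n > 0" using \<beta> by simp
  define e where "e = \<bar>real m - real n / 3\<bar>"
  define a where "a = \<bar>real N - real n / 3\<bar>"
  have a: "0 \<le> a" "a \<le> \<beta> ^ 9" using N by (auto simp: a_def)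
  have e0: "0 \<le> e" by (simp add: e_def)
  have inc: "X1 n m \<sigma> - X1 n N \<sigma> \<le> real n * (iso_rate (real m / real n) - iso_rate (real N / real n))
      + \<beta> * sqrt (3 * (e + a) + 1)"
  proof -
    have "\<bar>X1 n m \<sigma> - X1 n N \<sigma> - real n * (iso_rate (real m / real n) - iso_rate (real N / real n))\<bar>
       \<le> \<beta> * sqrt (3 * \<bar>real m - real N\<bar> + 1)"
    proof (cases "N \<le> m")
      case True
      then show ?thesis using reg m(1) unfolding regular_increments_def by auto
    next
      case False
      then have "\<bar>X1 n N \<sigma> - X1 n m \<sigma> - real n * (iso_rate (real N / real n) - iso_rate (real m / real n))\<bar>
        \<le> \<beta> * sqrt (3 * (real N - real m) + 1)"
        using reg N(1) unfolding regular_increments_def by auto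
      moreover have "X1 n m \<sigma> - X1 n N \<sigma> - real n * (iso_rate (real m / real n) - iso_rate (real N / real n))
        = - (X1 n N \<sigma> - X1 n m \<sigma> - real n * (iso_rate (real N / real n) - iso_rate (real m / real n)))"
        by (simp add: algebra_simps)
      ultimately show ?thesis using False by (simp only: abs_minus_cancel) (simp add: abs_if)
    qed
    also have "\<dots> \<le> \<beta> * sqrt (3 * (e + a) + 1)"
    proof -
      have "\<bar>real m - real N\<bar> \<le> e + a" unfolding e_def a_def by linarith
      then show ?thesis using \<beta>(2) by (intro mult_left_mono real_sqrt_le_mono) auto
    qed
    finally show ?thesis by linarith
  qed
  \<comment> \<open>The loss at \<open>N\<close> is at most \<open>4/3 * a\<^sup>2 / n\<close>, and
    \<open>a \<le> \<beta> ^ 9\<close> with \<open>n = \<beta> ^ 16\<close>.\<close>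
  have up: "real n * (iso_rate (1/3) - iso_rate (real N / real n)) \<le> 4/3 * \<beta>\<^sup>2"
  proof -
    have "real n * (iso_rate (1/3) - iso_rate (real N / real n)) \<le> real n * ((real N / real n - 1/3)\<^sup>2 * (4/3))"
      unfolding iso_rate_third by (intro mult_left_mono) auto
    also have "(real N / real n - 1/3)\<^sup>2 = a\<^sup>2 / (real n)\<^sup>2"
      using n by (simp add: a_def power_divide[symmetric] diff_divide_distrib)
    also have "real n * (a\<^sup>2 / (real n)\<^sup>2 * (4/3)) = 4/3 * a\<^sup>2 / real n"
      using n by (simp add: power2_eq_square)
    also have "\<dots> \<le> 4/3 * (\<beta> ^ 9)\<^sup>2 / real n"
      using a by (intro divide_right_mono mult_left_mono power_mono) auto
    also have "(\<beta> ^ 9)\<^sup>2 = \<beta>\<^sup>2 * real n" using \<beta> by (simp flip: power_mult power_add)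
    finally show ?thesis using n by simp
  qed
  have down: "real n * (iso_rate (1/3) - iso_rate (real m / real n)) \<ge> e\<^sup>2 / (3 * real n)"
  proof -
    have "e\<^sup>2 / (3 * real n) = real n * ((real m / real n - 1/3)\<^sup>2 * (1/3))"
    proof -
      have "(real m / real n - 1/3)\<^sup>2 = e\<^sup>2 / (real n)\<^sup>2"
        using n by (simp add: e_def power_divide[symmetric] diff_divide_distrib)
      then show ?thesis using n by (simp add: power2_eq_square)
    qed
    also have "\<dots> \<le> real n * ((real m / real n - 1/3)\<^sup>2 * (4/3 - real m / real n))"
    proof -
      have "real m / real n \<le> 1" using m n by simp
      then have "1/3 \<le> 4/3 - real m / real n" by linarith
      then show ?thesis using n by (intro mult_left_mono) simp_all
    qed
    finally show ?thesis unfolding iso_rate_third .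
  qed
  have main: "X1 n m \<sigma> - X1 n N \<sigma> \<le> 4/3 * \<beta>\<^sup>2 - e\<^sup>2 / (3 * real n) + \<beta> * sqrt (3 * (e + a) + 1)"
    using inc up down by (simp add: algebra_simps)
  have b2: "4/3 * \<beta>\<^sup>2 \<le> \<beta> ^ 7"
  proof -
    have "4/3 * \<beta>\<^sup>2 \<le> \<beta> ^ 5 * \<beta>\<^sup>2"
      using power_mono[of 6 \<beta> 5] \<beta> by (intro mult_right_mono) auto
    then show ?thesis by (simp flip: power_add)
  qed
  \<comment> \<open>This makes the deviation \<open>a\<close> of \<open>N\<close> negligible against
    \<open>\<beta> ^ 12\<close>, so that \<open>3 * (e + a) + 1\<close> is at most 4 times the
    larger of \<open>e\<close> and \<open>\<beta> ^ 12\<close>.\<close>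
  have p3: "216 \<le> \<beta> ^ 3" using power_mono[of 6 \<beta> 3] \<beta> by simp
  have p9: "216 * \<beta> ^ 9 \<le> \<beta> ^ 12"
  proof -
    have "216 * \<beta> ^ 9 \<le> \<beta> ^ 3 * \<beta> ^ 9" using p3 \<beta> by (intro mult_right_mono) auto
    then show ?thesis by (simp flip: power_add)
  qed
  have p0: "1 \<le> \<beta> ^ 9" using \<beta> by (intro one_le_power) auto
  have "X1 n m \<sigma> - X1 n N \<sigma> \<le> 3 * \<beta> ^ 7"
  proof (cases "e \<le> \<beta> ^ 12")
    case True
    have "3 * (e + a) + 1 \<le> (2 * \<beta> ^ 6)\<^sup>2"
      using True a p9 p0 by (simp add: power_mult_distrib flip: power_mult)
    then have "sqrt (3 * (e + a) + 1) \<le> 2 * \<beta> ^ 6" using \<beta> by (intro real_le_lsqrt) auto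
    then have "\<beta> * sqrt (3 * (e + a) + 1) \<le> \<beta> * (2 * \<beta> ^ 6)" using \<beta> by (intro mult_left_mono) auto
    also have "\<dots> = 2 * \<beta> ^ 7" by (simp add: power_numeral_reduce)
    finally have "\<beta> * sqrt (3 * (e + a) + 1) \<le> 2 * \<beta> ^ 7" .
    moreover have "0 \<le> e\<^sup>2 / (3 * real n)" using n by simp
    ultimately show ?thesis using main b2 by linarith
  next
    case False
    define x where "x = sqrt e"
    have x: "e = x\<^sup>2" "x \<ge> 0" using e0 by (auto simp: x_def)
    have "(\<beta> ^ 6)\<^sup>2 \<le> x\<^sup>2" using False x by (simp flip: power_mult)
    then have xb: "\<beta> ^ 6 \<le> x" using x(2) by (rule power2_le_imp_le)
    have "3 * (e + a) + 1 \<le> (2 * x)\<^sup>2"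
      using False a p9 p0 by (simp add: power_mult_distrib flip: x(1))
    then have "sqrt (3 * (e + a) + 1) \<le> 2 * x" using x by (intro real_le_lsqrt) auto
    then have 1: "\<beta> * sqrt (3 * (e + a) + 1) \<le> \<beta> * (2 * x)" using \<beta> by (intro mult_left_mono) auto
    \<comment> \<open>Far from \<open>n / 3\<close> the fluctuation
      \<open>2 * \<beta> * \<surd>e\<close> is dominated by the quadratic loss:
      \<open>6 * \<beta> * n * x \<le> (\<beta> ^ 6) ^ 3 * x \<le> x ^ 4\<close>. The assumption
      \<open>\<beta> \<ge> 6\<close> absorbs the constant.\<close>
    have "(\<beta> * (2 * x)) * (3 * real n) = 6 * (\<beta> * real n) * x" by simp
    also have "\<dots> \<le> \<beta> * (\<beta> * real n) * x"
      using \<beta> x by (intro mult_right_mono) auto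
    also have "\<beta> * (\<beta> * real n) = (\<beta> ^ 6) ^ 3" unfolding \<beta>(1) by (simp flip: power_mult power_Suc)
    also have "(\<beta> ^ 6) ^ 3 * x \<le> x ^ 3 * x" using xb x \<beta> by (intro mult_right_mono power_mono) auto
    also have "x ^ 3 * x = e\<^sup>2" by (simp add: x(1) power2_eq_square power3_eq_cube)
    finally have "\<beta> * (2 * x) \<le> e\<^sup>2 / (3 * real n)" using n by (simp add: pos_le_divide_eq)
    with 1 main b2 show ?thesis using \<beta> by (smt (verit) zero_le_power)
  qed
  moreover have "X1 n N \<sigma> \<le> X1 n m \<sigma>" using X1_le_max[OF N(1), of \<sigma>] m(2) by linarith
  ultimately show ?thesis using m by simp
qed

section \<open>The exceptional event and the moments of the difference\<close>

definition irregularity :: "real \<Rightarrow> nat \<Rightarrow> (nat \<Rightarrow> nat) \<Rightarrow> real" where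
  "irregularity \<beta> n \<sigma> = (\<Sum>m\<in>{0..n}. \<Sum>m'\<in>{m..n}.
     exp (\<bar>X1 n m' \<sigma> - X1 n m \<sigma> - real n * (iso_rate (real m' / real n) - iso_rate (real m / real n))\<bar>
       / (12 * sqrt (3 * (real m' - real m) + 1))) * exp (- \<beta> / 12))"

lemma irregularity_nonneg: "0 \<le> irregularity \<beta> n \<sigma>"
  unfolding irregularity_def by (intro sum_nonneg) auto

text \<open>A violating pair of times has an exponent above \<open>\<beta> / 12\<close>, so its term
  alone is at least 1. Thus \<open>irregularity\<close> dominates the indicator of failure and
  combines Markov's inequality with the union bound in a single expectation.\<close>

lemma one_le_irregularity:
  assumes "\<not> regular_increments \<beta> n \<sigma>"
  shows "1 \<le> irregularity \<beta> n \<sigma>"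
proof -
  define T where "T m m' = exp (\<bar>X1 n m' \<sigma> - X1 n m \<sigma> - real n * (iso_rate (real m' / real n) - iso_rate (real m / real n))\<bar>
       / (12 * sqrt (3 * (real m' - real m) + 1))) * exp (- \<beta> / 12)" for m m'
  have T0: "0 \<le> T m m'" for m m' by (simp add: T_def)
  obtain m m' where m: "m \<le> m'" "m' \<le> n" and
    gt: "\<beta> * sqrt (3 * (real m' - real m) + 1) < \<bar>X1 n m' \<sigma> - X1 n m \<sigma> - real n * (iso_rate (real m' / real n) - iso_rate (real m / real n))\<bar>"
    using assms unfolding regular_increments_def by (auto simp: not_le)
  have s: "sqrt (3 * (real m' - real m) + 1) > 0" using m by simp
  have "1 \<le> T m m'"
  proof -
    have "\<beta> / 12 \<le> \<bar>X1 n m' \<sigma> - X1 n m \<sigma> - real n * (iso_rate (real m' / real n) - iso_rate (real m / real n))\<bar>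
       / (12 * sqrt (3 * (real m' - real m) + 1))"
      using gt s by (simp add: pos_le_divide_eq)
    then show ?thesis unfolding T_def by (simp flip: exp_add)
  qed
  also have "\<dots> \<le> (\<Sum>m'\<in>{m..n}. T m m')" by (rule member_le_sum) (use m T0 in auto)
  also have "\<dots> \<le> (\<Sum>m\<in>{0..n}. \<Sum>m'\<in>{m..n}. T m m')"
    by (rule member_le_sum[of m "{0..n}" "\<lambda>m. \<Sum>m'\<in>{m..n}. T m m'"]) (use m T0 in \<open>auto intro: sum_nonneg\<close>)
  finally show ?thesis unfolding irregularity_def T_def .
qed

text \<open>The third power of \<open>n + 1\<close> from each increment and at most
  \<open>(n + 1)\<^sup>2\<close> pairs make the fifth power.\<close>

lemma expectation_irregularity:
  assumes n: "n \<ge> 3"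
  shows "measure_pmf.expectation (random_perm n) (irregularity \<beta> n)
     \<le> 3 * exp 3 * (real n + 1) ^ 5 * exp (- \<beta> / 12)"
proof -
  note int = integrable_measure_pmf_finite[OF finite_random_perm, where 'b = real]
  define K where "K = 3 * exp 3 * (real n + 1) ^ 3 * exp (- \<beta> / 12)"
  have K0: "0 \<le> K" by (simp add: K_def)
  have "measure_pmf.expectation (random_perm n) (irregularity \<beta> n) \<le> (\<Sum>m\<in>{0..n}. \<Sum>m'\<in>{m..n}. K)"
    unfolding irregularity_def
    apply (subst Bochner_Integration.integral_sum, rule int, rule sum_mono)
    apply (subst Bochner_Integration.integral_sum, rule int, rule sum_mono)
    subgoal for m m'
      using isolated_increment_moment[OF n, of m m'] by (auto simp: K_def int intro!: mult_right_mono)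
    done
  also have "\<dots> \<le> (\<Sum>m\<in>{0..n}. (real n + 1) * K)"
    by (intro sum_mono) (use K0 in \<open>auto intro!: mult_right_mono\<close>)
  also have "\<dots> = (real n + 1)\<^sup>2 * K" by (simp add: power2_eq_square algebra_simps)
  also have "\<dots> = 3 * exp 3 * (real n + 1) ^ 5 * exp (- \<beta> / 12)"
    unfolding K_def by (simp add: power_numeral_reduce)
  finally show ?thesis .
qed

text \<open>Either the increments are regular and \<open>N\<close> is near \<open>n / 3\<close>, so
  the deterministic bound applies, or the difference is at most \<open>n\<close> while
  \<open>irregularity + J\<close> is at least 1.\<close>

lemma expectation_X1_max_diff:
  assumes \<beta>: "real n = \<beta> ^ 16" "\<beta> \<ge> 6" and n: "n \<ge> 3"
  shows "measure_pmf.expectation (Pi_pmf {1..n} False (\<lambda>_. bernoulli_pmf (1/3))) (\<lambda>b.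
      measure_pmf.expectation (random_perm n) (\<lambda>\<sigma>. \<bar>X1_max n \<sigma> - X1 n (card {k\<in>{1..n}. b k}) \<sigma>\<bar> ^ p))
    \<le> (3 * \<beta> ^ 7) ^ p + real n ^ p * ((3 * exp 3 * (real n + 1) ^ 5 + 3) * exp (- \<beta> / 12))"
proof -
  define Q where "Q = Pi_pmf {1..n} False (\<lambda>_. bernoulli_pmf (1/3))"
  define N where "N b = card {k\<in>{1..n}. b k}" for b
  have finQ: "finite (set_pmf Q)" unfolding Q_def
    by (rule finite_set_Pi_pmf) (auto intro: finite_subset[OF subset_UNIV])
  note int = integrable_measure_pmf_finite[OF finite_random_perm, where 'b = real]
  note intQ = integrable_measure_pmf_finite[OF finQ, where 'b = real]
  have N: "N b \<le> n" for b
  proof -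
    have "card {k\<in>{1..n}. b k} \<le> card {1..n}" by (rule card_mono) auto
    then show ?thesis by (simp add: N_def)
  qed
  have sn: "sqrt (real n) = \<beta> ^ 8"
    using \<beta> real_sqrt_abs[of "\<beta> ^ 8"] by (simp flip: power_mult)
  \<comment> \<open>\<open>J\<close> dominates the indicator of
    \<open>\<bar>N - n / 3\<bar> > \<beta> ^ 9\<close>, because \<open>\<beta> ^ 9\<close> is
    \<open>\<beta>\<close> times \<open>\<surd>n\<close>.\<close>
  define J where "J b = exp (\<bar>real (N b) - real n / 3\<bar> / (12 * sqrt (real n))) * exp (- \<beta> / 12)" for b
  have EJ: "measure_pmf.expectation Q J \<le> 3 * exp (- \<beta> / 12)"
    using bernoulli_count_moment[of n] n unfolding J_def[abs_def] N_def Q_def by simp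
  have pw: "\<bar>X1_max n \<sigma> - X1 n (N b) \<sigma>\<bar> ^ p \<le> (3 * \<beta> ^ 7) ^ p + real n ^ p * irregularity \<beta> n \<sigma> + real n ^ p * J b"
    for b \<sigma>
  proof (cases "regular_increments \<beta> n \<sigma> \<and> \<bar>real (N b) - real n / 3\<bar> \<le> \<beta> ^ 9")
    case True
    then have "\<bar>X1_max n \<sigma> - X1 n (N b) \<sigma>\<bar> ^ p \<le> (3 * \<beta> ^ 7) ^ p"
      using X1_max_near_third[OF _ N _ \<beta>] by (intro power_mono) auto
    moreover have "0 \<le> real n ^ p * irregularity \<beta> n \<sigma>" "0 \<le> real n ^ p * J b"
      by (auto simp: irregularity_nonneg J_def)
    ultimately show ?thesis by linarith
  next
    case False
    have "0 \<le> X1_max n \<sigma>" "X1_max n \<sigma> \<le> real n"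
      using X1_max_attained[of n \<sigma>] X1_bounds by auto
    then have "\<bar>X1_max n \<sigma> - X1 n (N b) \<sigma>\<bar> ^ p \<le> real n ^ p"
      using X1_bounds[of n "N b" \<sigma>] by (intro power_mono) (auto simp: abs_if)
    also have "\<dots> \<le> real n ^ p * (irregularity \<beta> n \<sigma> + J b)"
    proof -
      have "1 \<le> irregularity \<beta> n \<sigma> + J b"
      proof (cases "regular_increments \<beta> n \<sigma>")
        case True
        then have "\<beta> ^ 9 < \<bar>real (N b) - real n / 3\<bar>" using False by simp
        then have "\<beta> / 12 \<le> \<bar>real (N b) - real n / 3\<bar> / (12 * sqrt (real n))"
          using \<beta> unfolding sn by (simp add: pos_le_divide_eq flip: power_Suc)
        then have "1 \<le> J b" unfolding J_def by (simp flip: exp_add)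
        then show ?thesis using irregularity_nonneg[of \<beta> n \<sigma>] by linarith
      next
        case False
        then show ?thesis using one_le_irregularity[OF False] by (simp add: J_def add_increasing2)
      qed
      then show ?thesis by (simp add: mult_le_cancel_left1)
    qed
    also have "\<dots> \<le> (3 * \<beta> ^ 7) ^ p + real n ^ p * irregularity \<beta> n \<sigma> + real n ^ p * J b"
      using \<beta> by (simp add: distrib_left)
    finally show ?thesis .
  qed
  have "measure_pmf.expectation Q (\<lambda>b. measure_pmf.expectation (random_perm n) (\<lambda>\<sigma>. \<bar>X1_max n \<sigma> - X1 n (N b) \<sigma>\<bar> ^ p))
    \<le> measure_pmf.expectation Q (\<lambda>b. measure_pmf.expectation (random_perm n)
        (\<lambda>\<sigma>. (3 * \<beta> ^ 7) ^ p + real n ^ p * irregularity \<beta> n \<sigma> + real n ^ p * J b))"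
    by (intro integral_mono int intQ pw)
  also have "\<dots> = (3 * \<beta> ^ 7) ^ p + real n ^ p * measure_pmf.expectation (random_perm n) (irregularity \<beta> n)
        + real n ^ p * measure_pmf.expectation Q J"
    by (simp add: int intQ)
  also have "\<dots> \<le> (3 * \<beta> ^ 7) ^ p + real n ^ p * (3 * exp 3 * (real n + 1) ^ 5 * exp (- \<beta> / 12))
        + real n ^ p * (3 * exp (- \<beta> / 12))"
    by (intro add_mono mult_left_mono expectation_irregularity[OF n] EJ) auto
  also have "\<dots> = (3 * \<beta> ^ 7) ^ p + real n ^ p * ((3 * exp 3 * (real n + 1) ^ 5 + 3) * exp (- \<beta> / 12))"
    by (simp add: algebra_simps)
  finally show ?thesis unfolding Q_def N_def .
qed

subsection \<open>Convergence of moments and the normal law\<close>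

lemma abs_power_le_Suc: "\<bar>x\<bar> ^ r \<le> 1 + \<bar>x :: real\<bar> ^ Suc r"
proof (cases "\<bar>x\<bar> \<le> 1")
  case True
  then have "\<bar>x\<bar> ^ r \<le> 1" by (simp add: power_le_one)
  then show ?thesis by (simp add: add_increasing2)
next
  case False
  then have "\<bar>x\<bar> ^ r \<le> \<bar>x\<bar> ^ Suc r" by (intro power_increasing) auto
  then show ?thesis by simp
qed

lemma clip_power_le:
  fixes x :: real
  assumes "K > 0"
  shows "norm ((max (- K) (min K x)) ^ r) \<le> K ^ r"
  unfolding norm_power using assms by (intro power_mono) (auto simp: max_def min_def abs_if)

lemma clip_power_error:
  fixes x :: real
  assumes K: "K > 0"
  shows "\<bar>x ^ r - (max (- K) (min K x)) ^ r\<bar> \<le> 2 * \<bar>x\<bar> ^ Suc r / K"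
proof (cases "\<bar>x\<bar> \<le> K")
  case True
  then have "max (- K) (min K x) = x" by auto
  then show ?thesis using K by simp
next
  case False
  have "\<bar>x ^ r - (max (- K) (min K x)) ^ r\<bar> \<le> \<bar>x\<bar> ^ r + \<bar>max (- K) (min K x)\<bar> ^ r"
    by (simp flip: power_abs)
  also have "\<dots> \<le> \<bar>x\<bar> ^ r + \<bar>x\<bar> ^ r"
    using False K by (intro add_left_mono power_mono) (auto simp: max_def min_def abs_if)
  also have "\<dots> = 2 * \<bar>x\<bar> ^ r * 1" by simp
  also have "\<dots> \<le> 2 * \<bar>x\<bar> ^ r * (\<bar>x\<bar> / K)"
    using False K by (intro mult_left_mono) auto
  finally show ?thesis by (simp add: mult_ac)
qed

text \<open>The clipped power is bounded and continuous, so its integrals converge. Clipping at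
  \<open>K\<close> costs at most \<open>2 / K\<close> times the absolute moment of order
  \<open>r + 1\<close>, uniformly for large \<open>n\<close>.\<close>

lemma weak_conv_imp_moments_conv:
  fixes M :: "nat \<Rightarrow> real measure" and M' :: "real measure"
  assumes M: "\<And>n. real_distribution (M n)" and M': "real_distribution M'"
    and conv: "weak_conv_m M M'"
    and int: "\<And>n. integrable (M n) (\<lambda>x. \<bar>x\<bar> ^ Suc r)" and int': "integrable M' (\<lambda>x. \<bar>x\<bar> ^ Suc r)"
    and bound: "eventually (\<lambda>n. (LINT x|M n. \<bar>x\<bar> ^ Suc r) \<le> C) sequentially"
  shows "(\<lambda>n. LINT x|M n. x ^ r) \<longlonglongrightarrow> (LINT x|M'. x ^ r)"
proof -
  define \<phi> where "\<phi> K x = (max (- K) (min K x)) ^ r" for K x :: real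
  define C' where "C' = max 0 (max C (LINT x|M'. \<bar>x\<bar> ^ Suc r))"
  have near: "\<bar>(LINT x|N. x ^ r) - (LINT x|N. \<phi> K x)\<bar> \<le> 2 * (LINT x|N. \<bar>x\<bar> ^ Suc r) / K"
    if N: "real_distribution N" and i: "integrable N (\<lambda>x. \<bar>x\<bar> ^ Suc r)" and K: "K > 0" for N K
  proof -
    interpret N: real_distribution N by fact
    have ix: "integrable N (\<lambda>x. x ^ r)"
    proof (rule Bochner_Integration.integrable_bound)
      show "integrable N (\<lambda>x. 1 + \<bar>x\<bar> ^ Suc r)" by (intro Bochner_Integration.integrable_add i) simp
      show "AE x in N. norm (x ^ r) \<le> norm (1 + \<bar>x\<bar> ^ Suc r)"
        using abs_power_le_Suc[of _ r] by (auto simp: power_abs)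
    qed simp
    have ip: "integrable N (\<phi> K)"
    proof (rule N.integrable_const_bound)
      show "AE x in N. norm (\<phi> K x) \<le> K ^ r"
        unfolding \<phi>_def using clip_power_le[OF K] by simp
      show "\<phi> K \<in> borel_measurable N" unfolding \<phi>_def[abs_def] by simp
    qed
    have "\<bar>(LINT x|N. x ^ r) - (LINT x|N. \<phi> K x)\<bar> = \<bar>LINT x|N. x ^ r - \<phi> K x\<bar>"
      using ix ip by simp
    also have "\<dots> \<le> (LINT x|N. \<bar>x ^ r - \<phi> K x\<bar>)" by (rule integral_abs_bound)
    also have "\<dots> \<le> (LINT x|N. 2 * \<bar>x\<bar> ^ Suc r / K)"
      using ix ip i clip_power_error[OF K, of _ r] unfolding \<phi>_def by (intro integral_mono) auto
    also have "\<dots> = 2 * (LINT x|N. \<bar>x\<bar> ^ Suc r) / K" by simp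
    finally show ?thesis .
  qed
  show ?thesis
  proof (rule LIMSEQ_I)
    fix \<epsilon> :: real assume \<epsilon>: "0 < \<epsilon>"
    \<comment> \<open>The two clipping errors become at most \<open>\<epsilon> / 4\<close> each, and
      weak convergence contributes less than \<open>\<epsilon> / 4\<close>; the \<open>+ 1\<close>
      keeps \<open>K\<close> positive.\<close>
    define K where "K = 8 * (C' + 1) / \<epsilon>"
    have C'0: "0 \<le> C'" by (simp add: C'_def)
    have K: "K > 0" using \<epsilon> C'0 by (simp add: K_def)
    have small: "2 * c / K \<le> \<epsilon> / 4" if "c \<le> C'" for c
    proof -
      have "2 * c / K \<le> 2 * (C' + 1) / K" using that K by (intro divide_right_mono) auto
      also have "\<dots> = \<epsilon> / 4" using C'0 \<epsilon> by (simp add: K_def field_simps)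
      finally show ?thesis .
    qed
    have "(\<lambda>n. LINT x|M n. \<phi> K x) \<longlonglongrightarrow> (LINT x|M'. \<phi> K x)"
    proof (rule weak_conv_imp_integral_bdd_continuous_conv[OF M M' conv, where B = "K ^ r"])
      show "isCont (\<phi> K) x" for x unfolding \<phi>_def by (intro continuous_intros)
      show "norm (\<phi> K x) \<le> K ^ r" for x
        unfolding \<phi>_def using clip_power_le[OF K] by simp
    qed
    then have "eventually (\<lambda>n. dist (LINT x|M n. \<phi> K x) (LINT x|M'. \<phi> K x) < \<epsilon> / 4) sequentially"
      using \<epsilon> by (intro tendstoD) auto
    with bound have "eventually (\<lambda>n. norm ((LINT x|M n. x ^ r) - (LINT x|M'. x ^ r)) < \<epsilon>) sequentially"
    proof eventually_elim
      case (elim n)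
      have "\<bar>(LINT x|M n. x ^ r) - (LINT x|M n. \<phi> K x)\<bar> \<le> \<epsilon> / 4"
        by (rule order_trans[OF near[OF M int K] small]) (use elim in \<open>simp add: C'_def\<close>)
      moreover have "\<bar>(LINT x|M'. x ^ r) - (LINT x|M'. \<phi> K x)\<bar> \<le> \<epsilon> / 4"
        by (rule order_trans[OF near[OF M' int' K] small]) (simp add: C'_def)
      ultimately show ?case using elim \<epsilon> unfolding dist_real_def real_norm_def by linarith
    qed
    then show "\<exists>no. \<forall>n\<ge>no. norm ((LINT x|M n. x ^ r) - (LINT x|M'. x ^ r)) < \<epsilon>"
      by (simp add: eventually_sequentially)
  qed
qed

section \<open>Normal laws: characteristic function and moments\<close>

lemma normal_law_eq_distr:
  assumes "v > 0"
  shows "normal_law 0 v = distr std_normal_distribution borel (\<lambda>x. sqrt v * x)"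
proof -
  interpret prob_space std_normal_distribution by (rule real_distribution.axioms(1)[OF real_dist_normal_dist])
  have "distributed std_normal_distribution lborel (\<lambda>x. x) std_normal_density"
    unfolding distributed_def by (auto simp: distr_id2)
  from normal_density_affine[OF this, of "sqrt v" 0] assms
  have "distributed std_normal_distribution lborel (\<lambda>x. sqrt v * x) (normal_density 0 (sqrt v))" by simp
  then have "distr std_normal_distribution lborel (\<lambda>x. sqrt v * x) = density lborel (normal_density 0 (sqrt v))"
    by (simp add: distributed_def)
  moreover have "distr std_normal_distribution lborel (\<lambda>x. sqrt v * x) = distr std_normal_distribution borel (\<lambda>x. sqrt v * x)"
    by (rule distr_cong) auto
  ultimately show ?thesis by (simp add: normal_law_def)
qed

lemma real_distribution_normal_law: "v > 0 \<Longrightarrow> real_distribution (normal_law 0 v)"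
  unfolding normal_law_eq_distr
  by (intro prob_space.real_distribution_distr real_distribution.axioms(1)[OF real_dist_normal_dist]) simp

lemma char_normal_law:
  assumes "v > 0"
  shows "char (normal_law 0 v) t = exp (- v * t\<^sup>2 / 2)"
proof -
  have "char (normal_law 0 v) t = char std_normal_distribution (sqrt v * t)"
    unfolding normal_law_eq_distr[OF assms] char_def
    by (subst integral_distr) (auto simp: mult_ac)
  also have "\<dots> = exp (- v * t\<^sup>2 / 2)"
    using assms by (simp add: char_std_normal_distribution power_mult_distrib)
  finally show ?thesis .
qed

lemma integral_normal_law:
  assumes "f \<in> borel_measurable borel"
  shows "(LINT x|normal_law 0 v. f x) = (LINT x|lborel. normal_density 0 (sqrt v) x * f x)"
  unfolding normal_law_def using assms by (subst integral_density) auto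

lemma integrable_normal_law_power:
  assumes "v > 0"
  shows "integrable (normal_law 0 v) (\<lambda>x. \<bar>x\<bar> ^ k)"
proof -
  have "integrable lborel (\<lambda>x. normal_density 0 (sqrt v) x * \<bar>x - 0\<bar> ^ k)"
    by (rule integrable_normal_moment_abs) (use assms in simp)
  then show ?thesis unfolding normal_law_def by (subst integrable_density) auto
qed

lemma normal_law_moments:
  assumes "v > 0"
  shows "(LINT x|normal_law 0 v. x) = 0" "(LINT x|normal_law 0 v. x\<^sup>2) = v"
proof -
  have s: "0 < sqrt v" using assms by simp
  show "(LINT x|normal_law 0 v. x) = 0"
    using integral_normal_moment_nz_1[OF s, of 0] by (simp add: integral_normal_law)
  show "(LINT x|normal_law 0 v. x\<^sup>2) = v"
    using integral_normal_moment_even[OF s, of 0 1] assms by (simp add: integral_normal_law power_divide)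
qed

text \<open>In terms of \<open>y = n powr (1/16) / 12\<close> the power \<open>n ^ (p + 5)\<close>
  becomes \<open>(12 * y) ^ (16 * (p + 5))\<close>, a fixed power of \<open>y\<close> against
  \<open>exp (- y)\<close>.\<close>

lemma power_times_exp_decay:
  "((\<lambda>n. real n ^ p * ((3 * exp 3 * (real n + 1) ^ 5 + 3) * exp (- (real n powr (1/16)) / 12))) \<longlongrightarrow> 0) sequentially"
proof -
  define k where "k = 16 * (p + 5)"
  \<comment> \<open>From \<open>(n + 1) ^ 5 \<le> 32 * n ^ 5\<close>, with
    \<open>96 = 3 * 32\<close>.\<close>
  define C :: real where "C = 96 * exp 3 + 3"
  define y where "y n = real n powr (1/16) / 12" for n
  have y: "filterlim y at_top sequentially" unfolding y_def by real_asymp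
  have "((\<lambda>n. y n ^ k / exp (y n)) \<longlongrightarrow> 0) sequentially"
    by (rule filterlim_compose[OF tendsto_power_div_exp_0 y])
  then have "((\<lambda>n. C * 12 ^ k * (y n ^ k / exp (y n))) \<longlongrightarrow> 0) sequentially"
    by (rule tendsto_mult_right_zero)
  moreover have "eventually (\<lambda>n. norm (real n ^ p * ((3 * exp 3 * (real n + 1) ^ 5 + 3) * exp (- (real n powr (1/16)) / 12)))
      \<le> C * 12 ^ k * (y n ^ k / exp (y n))) sequentially"
    using eventually_ge_at_top[of 1]
  proof eventually_elim
    case (elim n)
    have n: "real n \<ge> 1" using elim by simp
    have "(real n + 1) ^ 5 \<le> (2 * real n) ^ 5" using n by (intro power_mono) auto
    also have "\<dots> = 32 * real n ^ 5" by (simp add: power_mult_distrib)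
    finally have "3 * exp 3 * (real n + 1) ^ 5 + 3 \<le> 3 * exp 3 * (32 * real n ^ 5) + 3 * real n ^ 5"
      using one_le_power[OF n, of 5] by (intro add_mono mult_left_mono) auto
    also have "\<dots> = C * real n ^ 5" by (simp add: C_def algebra_simps)
    finally have "real n ^ p * ((3 * exp 3 * (real n + 1) ^ 5 + 3) * exp (- (real n powr (1/16)) / 12))
      \<le> real n ^ p * (C * real n ^ 5 * exp (- (real n powr (1/16)) / 12))"
      by (intro mult_left_mono mult_right_mono) auto
    also have "\<dots> = C * real n ^ (p + 5) * exp (- y n)" by (simp add: power_add y_def)
    also have "real n ^ (p + 5) = (12 * y n) ^ k"
    proof -
      have "real n = (real n powr (1/16)) ^ 16" using n by (simp add: powr_powr flip: powr_realpow)
      then have "real n ^ (p + 5) = ((real n powr (1/16)) ^ 16) ^ (p + 5)" by simp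
      also have "\<dots> = (real n powr (1/16)) ^ k" by (simp only: k_def power_mult)
      finally show ?thesis by (simp add: y_def)
    qed
    also have "C * (12 * y n) ^ k * exp (- y n) = C * 12 ^ k * (y n ^ k / exp (y n))"
      by (simp add: power_mult_distrib exp_minus field_simps)
    finally show ?case by simp
  qed
  ultimately show ?thesis by (rule Lim_null_comparison[rotated])
qed

subsection \<open>The limit theorem\<close>

definition third_config :: "nat \<Rightarrow> (nat \<Rightarrow> bool) pmf" where
  "third_config n = Pi_pmf {1..n} False (\<lambda>_. bernoulli_pmf (1/3))"

definition Z_iid :: "nat \<Rightarrow> (nat \<Rightarrow> bool) \<Rightarrow> real" where
  "Z_iid n b = real n powr (-1/2) * (isolated n b - 4/27 * real n)"

text \<open>The process at the random time \<open>N\<close>, normalised. With \<open>b\<close> and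
  \<open>\<sigma>\<close> independent it has the law of \<open>Z_iid\<close>, and it lives on the
  same space as \<open>Z1\<close>.\<close>

definition Z_stop :: "nat \<Rightarrow> (nat \<Rightarrow> bool) \<Rightarrow> (nat \<Rightarrow> nat) \<Rightarrow> real" where
  "Z_stop n b \<sigma> = real n powr (-1/2) * (X1 n (card {k\<in>{1..n}. b k}) \<sigma> - 4/27 * real n)"

text \<open>With \<open>\<beta> = n powr (1/16)\<close> the deterministic loss
  \<open>3 * \<beta> ^ 7\<close> divided by \<open>\<surd>n = \<beta> ^ 8\<close> is
  \<open>3 / \<beta>\<close>; the second term is the contribution of the exceptional event.\<close>

definition coupling_error :: "nat \<Rightarrow> nat \<Rightarrow> real" where
  "coupling_error p n = (3 / real n powr (1/16)) ^ p
     + real n ^ p * ((3 * exp 3 * (real n + 1) ^ 5 + 3) * exp (- (real n powr (1/16)) / 12))"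

lemma finite_third_config: "finite (set_pmf (third_config n))"
  unfolding third_config_def
  by (rule finite_set_Pi_pmf) (auto intro: finite_subset[OF subset_UNIV])

lemma coupling_error_tendsto_0:
  assumes "p > 0"
  shows "coupling_error p \<longlonglongrightarrow> 0"
proof -
  have "(\<lambda>n. 3 / real n powr (1/16)) \<longlonglongrightarrow> 0" by real_asymp
  then have "(\<lambda>n. (3 / real n powr (1/16)) ^ p) \<longlonglongrightarrow> 0" using assms by (rule tendsto_null_power)
  from tendsto_add[OF this power_times_exp_decay[of p]] show ?thesis
    unfolding coupling_error_def[abs_def] by simp
qed

lemma expectation_Z_iid:
  fixes f :: "real \<Rightarrow> 'b::{banach, second_countable_topology}"
  assumes "n > 0"
  shows "measure_pmf.expectation (third_config n) (\<lambda>b. f (Z_iid n b))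
     = measure_pmf.expectation (third_config n) (\<lambda>b. measure_pmf.expectation (random_perm n) (\<lambda>\<sigma>. f (Z_stop n b \<sigma>)))"
proof -
  have "depends_on (isolated n) {1..n}"
    using isolated_cong[OF assms] unfolding depends_on_def by blast
  then have "depends_on (\<lambda>b. f (Z_iid n b)) {1..n}" unfolding Z_iid_def by (rule depends_on_comp)
  from expectation_iid_bool_perm[OF this] show ?thesis
    unfolding third_config_def Z_iid_def Z_stop_def X1_eq_isolated .
qed

lemma coupling_moment:
  assumes n: "n \<ge> 6 ^ 16"
  shows "measure_pmf.expectation (third_config n) (\<lambda>b. measure_pmf.expectation (random_perm n)
      (\<lambda>\<sigma>. \<bar>Z1 n \<sigma> - Z_stop n b \<sigma>\<bar> ^ p)) \<le> coupling_error p n"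
proof -
  define \<beta> where "\<beta> = real n powr (1/16)"
  have n0: "n > 0" "n \<ge> 3" using n by auto
  have \<beta>: "real n = \<beta> ^ 16" using n0 by (simp add: \<beta>_def powr_powr flip: powr_realpow)
  \<comment> \<open>The threshold \<open>6 ^ 16\<close> for \<open>n\<close> is the requirement
    \<open>\<beta> \<ge> 6\<close> of the deterministic comparison.\<close>
  have \<beta>6: "\<beta> \<ge> 6"
  proof (rule ccontr)
    assume "\<not> 6 \<le> \<beta>"
    then have "\<beta> ^ 16 < 6 ^ 16" by (intro power_strict_mono) (auto simp: \<beta>_def)
    then have "real n < real (6 ^ 16)" using \<beta> by simp
    then show False using n by linarith
  qed
  have r: "real n powr (-1/2) = 1 / \<beta> ^ 8"
    using n0 by (simp add: \<beta>_def powr_powr powr_minus_divide flip: powr_realpow)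
  have diff: "\<bar>Z1 n \<sigma> - Z_stop n b \<sigma>\<bar> ^ p
      = (1 / \<beta> ^ 8) ^ p * \<bar>X1_max n \<sigma> - X1 n (card {k\<in>{1..n}. b k}) \<sigma>\<bar> ^ p" for b \<sigma>
  proof -
    have "Z1 n \<sigma> - Z_stop n b \<sigma> = 1 / \<beta> ^ 8 * (X1_max n \<sigma> - X1 n (card {k\<in>{1..n}. b k}) \<sigma>)"
      unfolding Z1_def Z_stop_def r by (simp add: algebra_simps diff_divide_distrib)
    then show ?thesis using \<beta>6 by (simp only: abs_mult power_mult_distrib) simp
  qed
  define R where "R = real n ^ p * ((3 * exp 3 * (real n + 1) ^ 5 + 3) * exp (- \<beta> / 12))"
  have "measure_pmf.expectation (third_config n) (\<lambda>b. measure_pmf.expectation (random_perm n)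
      (\<lambda>\<sigma>. \<bar>Z1 n \<sigma> - Z_stop n b \<sigma>\<bar> ^ p))
     = (1 / \<beta> ^ 8) ^ p * measure_pmf.expectation (third_config n) (\<lambda>b. measure_pmf.expectation (random_perm n)
      (\<lambda>\<sigma>. \<bar>X1_max n \<sigma> - X1 n (card {k\<in>{1..n}. b k}) \<sigma>\<bar> ^ p))"
    unfolding diff by simp
  also have "\<dots> \<le> (1 / \<beta> ^ 8) ^ p * ((3 * \<beta> ^ 7) ^ p + R)"
    unfolding third_config_def R_def using \<beta>6
    by (intro mult_left_mono expectation_X1_max_diff \<beta> \<beta>6 n0) auto
  also have "\<dots> = (3 / \<beta>) ^ p + (1 / \<beta> ^ 8) ^ p * R"
  proof -
    have "1 / \<beta> ^ 8 * (3 * \<beta> ^ 7) = 3 / \<beta>" using \<beta>6 by (simp add: power_numeral_reduce)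
    then show ?thesis by (simp only: distrib_left power_mult_distrib[symmetric])
  qed
  also have "\<dots> \<le> (3 / \<beta>) ^ p + 1 * R"
  proof -
    have "(1 / \<beta> ^ 8) ^ p \<le> 1" using \<beta>6 by (intro power_le_one) (auto intro: one_le_power)
    moreover have "0 \<le> R" by (simp add: R_def)
    ultimately show ?thesis by (intro add_left_mono mult_right_mono)
  qed
  finally show ?thesis by (simp add: coupling_error_def R_def \<beta>_def)
qed

text \<open>\<open>Z_iid\<close> is exchanged for \<open>Z_stop\<close>, which has the same law; as
  \<open>iexp\<close> is 1-Lipschitz, the first moment of the coupling difference suffices.\<close>

lemma char_coupling:
  assumes n: "n \<ge> 6 ^ 16"
  shows "norm (measure_pmf.expectation (random_perm n) (\<lambda>\<sigma>. iexp (t * Z1 n \<sigma>))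
      - measure_pmf.expectation (third_config n) (\<lambda>b. iexp (t * Z_iid n b))) \<le> \<bar>t\<bar> * coupling_error 1 n"
proof -
  have n0: "n > 0" using n by auto
  note int = integrable_measure_pmf_finite[OF finite_random_perm]
  note intQ = integrable_measure_pmf_finite[OF finite_third_config]
  let ?E = "measure_pmf.expectation (third_config n)"
  let ?F = "measure_pmf.expectation (random_perm n)"
  have "?F (\<lambda>\<sigma>. iexp (t * Z1 n \<sigma>)) - ?E (\<lambda>b. iexp (t * Z_iid n b))
     = ?E (\<lambda>b. ?F (\<lambda>\<sigma>. iexp (t * Z1 n \<sigma>) - iexp (t * Z_stop n b \<sigma>)))"
    unfolding expectation_Z_iid[OF n0, of "\<lambda>x. iexp (t * x)"] by (simp add: int intQ)
  also have "norm \<dots> \<le> ?E (\<lambda>b. norm (?F (\<lambda>\<sigma>. iexp (t * Z1 n \<sigma>) - iexp (t * Z_stop n b \<sigma>))))"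
    by (rule integral_norm_bound)
  also have "\<dots> \<le> ?E (\<lambda>b. ?F (\<lambda>\<sigma>. \<bar>t\<bar> * \<bar>Z1 n \<sigma> - Z_stop n b \<sigma>\<bar> ^ 1))"
  proof (intro integral_mono intQ)
    fix b
    have "norm (?F (\<lambda>\<sigma>. iexp (t * Z1 n \<sigma>) - iexp (t * Z_stop n b \<sigma>)))
      \<le> ?F (\<lambda>\<sigma>. norm (iexp (t * Z1 n \<sigma>) - iexp (t * Z_stop n b \<sigma>)))"
      by (rule integral_norm_bound)
    also have "\<dots> \<le> ?F (\<lambda>\<sigma>. \<bar>t\<bar> * \<bar>Z1 n \<sigma> - Z_stop n b \<sigma>\<bar> ^ 1)"
      by (intro integral_mono int order_trans[OF norm_iexp_diff_le])
         (simp add: abs_mult flip: right_diff_distrib)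
    finally show "norm (?F (\<lambda>\<sigma>. iexp (t * Z1 n \<sigma>) - iexp (t * Z_stop n b \<sigma>))) \<le> \<dots>" .
  qed
  also have "\<dots> = \<bar>t\<bar> * ?E (\<lambda>b. ?F (\<lambda>\<sigma>. \<bar>Z1 n \<sigma> - Z_stop n b \<sigma>\<bar> ^ 1))" by simp
  also have "\<dots> \<le> \<bar>t\<bar> * coupling_error 1 n" by (intro mult_left_mono coupling_moment n) auto
  finally show ?thesis .
qed

text \<open>At the argument \<open>t * n powr (-1/2)\<close> the cubic error
  \<open>n * 263 * \<bar>s\<bar> ^ 3\<close> is of order \<open>n powr (-1/2)\<close>.\<close>

lemma char_Z_iid_tendsto:
  "(\<lambda>n. measure_pmf.expectation (third_config n) (\<lambda>b. iexp (t * Z_iid n b)))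
     \<longlonglongrightarrow> complex_of_real (exp (- (76/729) * t\<^sup>2 / 2))"
proof -
  have "(\<lambda>n. measure_pmf.expectation (third_config n) (\<lambda>b. iexp (t * Z_iid n b))
      - complex_of_real (exp (- (76/729) * t\<^sup>2 / 2))) \<longlonglongrightarrow> 0"
  proof (rule Lim_null_comparison)
    show "eventually (\<lambda>n. norm (measure_pmf.expectation (third_config n) (\<lambda>b. iexp (t * Z_iid n b))
      - complex_of_real (exp (- (76/729) * t\<^sup>2 / 2))) \<le> 263 * \<bar>t\<bar> ^ 3 * real n powr (-1/2)) sequentially"
      using eventually_ge_at_top[of 5]
    proof eventually_elim
      case (elim n)
      define r where "r = real n powr (-1/2)"
      have r2: "real n * r\<^sup>2 = 1"
        using elim by (simp add: r_def powr_minus_divide powr_half_sqrt power_divide)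
      have "s * (r * x) = (s * r) * x" for s x :: real by simp
      then have "norm (measure_pmf.expectation (third_config n) (\<lambda>b. iexp (t * Z_iid n b))
        - exp (- (76/729 * real n) * (t * r)\<^sup>2 / 2)) \<le> real n * 263 * \<bar>t * r\<bar> ^ 3"
        using char_isolated_bernoulli[OF elim, of "t * r"] unfolding third_config_def Z_iid_def r_def[symmetric]
        by (simp only:)
      also have "- (76/729 * real n) * (t * r)\<^sup>2 / 2 = - (76/729) * t\<^sup>2 / 2 * (real n * r\<^sup>2)"
        by (simp add: power_mult_distrib)
      also have "\<dots> = - (76/729) * t\<^sup>2 / 2" unfolding r2 by simp
      also have "real n * 263 * \<bar>t * r\<bar> ^ 3 = 263 * \<bar>t\<bar> ^ 3 * r * (real n * r\<^sup>2)"
        by (simp add: abs_mult r_def power_mult_distrib power2_eq_square power3_eq_cube)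
      finally show ?case unfolding r2 by (simp add: r_def)
    qed
    have "(\<lambda>n. real n powr (-1/2)) \<longlonglongrightarrow> 0" by real_asymp
    then show "(\<lambda>n. 263 * \<bar>t\<bar> ^ 3 * real n powr (-1/2)) \<longlonglongrightarrow> 0" by (rule tendsto_mult_right_zero)
  qed
  then show ?thesis by (simp add: LIM_zero_iff)
qed

section \<open>Moment bounds and convergence to the normal law\<close>

lemma Z_iid_moment_bound:
  assumes n: "n \<ge> 3"
  shows "measure_pmf.expectation (third_config n) (\<lambda>b. \<bar>Z_iid n b\<bar> ^ p) \<le> 3 * 12 ^ p * fact p"
proof -
  note intQ = integrable_measure_pmf_finite[OF finite_third_config]
  have "\<bar>Z_iid n b\<bar> ^ p \<le> 12 ^ p * fact p * exp (\<bar>isolated n b - 4/27 * real n\<bar> / (12 * sqrt (real n)))" for b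
  proof -
    define y where "y = \<bar>isolated n b - 4/27 * real n\<bar> / (12 * sqrt (real n))"
    have "\<bar>Z_iid n b\<bar> = 12 * y"
      unfolding Z_iid_def y_def using n by (simp add: abs_mult powr_minus_divide powr_half_sqrt)
    then have "\<bar>Z_iid n b\<bar> ^ p = 12 ^ p * y ^ p" by (simp add: power_mult_distrib)
    also have "\<dots> \<le> 12 ^ p * (fact p * exp y)"
      by (intro mult_left_mono power_le_fact_mult_exp) (auto simp: y_def)
    finally show ?thesis by (simp add: y_def)
  qed
  then have "measure_pmf.expectation (third_config n) (\<lambda>b. \<bar>Z_iid n b\<bar> ^ p)
     \<le> measure_pmf.expectation (third_config n)
        (\<lambda>b. 12 ^ p * fact p * exp (\<bar>isolated n b - 4/27 * real n\<bar> / (12 * sqrt (real n))))"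
    by (intro integral_mono intQ)
  also have "\<dots> = 12 ^ p * fact p * measure_pmf.expectation (third_config n)
        (\<lambda>b. exp (\<bar>isolated n b - 4/27 * real n\<bar> / (12 * sqrt (real n))))" by simp
  also have "\<dots> \<le> 12 ^ p * fact p * 3"
    unfolding third_config_def by (intro mult_left_mono bernoulli_isolated_moment n) auto
  finally show ?thesis by simp
qed

lemma abs_add_power_le: "\<bar>x + y\<bar> ^ p \<le> 2 ^ p * (\<bar>x\<bar> ^ p + \<bar>y :: real\<bar> ^ p)"
proof -
  have "\<bar>x + y\<bar> ^ p \<le> (2 * max \<bar>x\<bar> \<bar>y\<bar>) ^ p" by (intro power_mono) auto
  also have "\<dots> = 2 ^ p * max \<bar>x\<bar> \<bar>y\<bar> ^ p" by (simp add: power_mult_distrib)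
  also have "max \<bar>x\<bar> \<bar>y\<bar> ^ p \<le> \<bar>x\<bar> ^ p + \<bar>y\<bar> ^ p" by (simp add: max_def)
  finally show ?thesis by simp
qed

lemma Z1_moment_bound:
  assumes n: "n \<ge> 6 ^ 16"
  shows "measure_pmf.expectation (random_perm n) (\<lambda>\<sigma>. \<bar>Z1 n \<sigma>\<bar> ^ p)
     \<le> 2 ^ p * (3 * 12 ^ p * fact p + coupling_error p n)"
proof -
  have n0: "n > 0" "n \<ge> 3" using n by auto
  note int = integrable_measure_pmf_finite[OF finite_random_perm]
  note intQ = integrable_measure_pmf_finite[OF finite_third_config]
  let ?E = "measure_pmf.expectation (third_config n)"
  let ?F = "measure_pmf.expectation (random_perm n)"
  have "?F (\<lambda>\<sigma>. \<bar>Z1 n \<sigma>\<bar> ^ p) = ?E (\<lambda>b. ?F (\<lambda>\<sigma>. \<bar>Z1 n \<sigma>\<bar> ^ p))" by simp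
  also have "\<dots> \<le> ?E (\<lambda>b. ?F (\<lambda>\<sigma>. 2 ^ p * (\<bar>Z_stop n b \<sigma>\<bar> ^ p + \<bar>Z1 n \<sigma> - Z_stop n b \<sigma>\<bar> ^ p)))"
  proof (intro integral_mono int intQ)
    fix b \<sigma>
    show "\<bar>Z1 n \<sigma>\<bar> ^ p \<le> 2 ^ p * (\<bar>Z_stop n b \<sigma>\<bar> ^ p + \<bar>Z1 n \<sigma> - Z_stop n b \<sigma>\<bar> ^ p)"
      using abs_add_power_le[of "Z_stop n b \<sigma>" "Z1 n \<sigma> - Z_stop n b \<sigma>" p] by simp
  qed
  also have "\<dots> = 2 ^ p * (?E (\<lambda>b. ?F (\<lambda>\<sigma>. \<bar>Z_stop n b \<sigma>\<bar> ^ p)) + ?E (\<lambda>b. ?F (\<lambda>\<sigma>. \<bar>Z1 n \<sigma> - Z_stop n b \<sigma>\<bar> ^ p)))"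
    by (simp add: int intQ)
  also have "?E (\<lambda>b. ?F (\<lambda>\<sigma>. \<bar>Z_stop n b \<sigma>\<bar> ^ p)) = ?E (\<lambda>b. \<bar>Z_iid n b\<bar> ^ p)"
    by (rule expectation_Z_iid[OF n0(1), symmetric])
  also have "2 ^ p * (?E (\<lambda>b. \<bar>Z_iid n b\<bar> ^ p) + ?E (\<lambda>b. ?F (\<lambda>\<sigma>. \<bar>Z1 n \<sigma> - Z_stop n b \<sigma>\<bar> ^ p)))
     \<le> 2 ^ p * (3 * 12 ^ p * fact p + coupling_error p n)"
    by (intro mult_left_mono add_mono Z_iid_moment_bound coupling_moment n n0) auto
  finally show ?thesis .
qed

lemma Z1_weak_conv:
  "weak_conv_m (\<lambda>n. distr (measure_pmf (random_perm n)) borel (Z1 n)) (normal_law 0 (76/729))"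
proof (rule levy_continuity)
  show "real_distribution (distr (measure_pmf (random_perm n)) borel (Z1 n))" for n
    by (rule prob_space.real_distribution_distr) (auto intro: prob_space_measure_pmf)
  show "real_distribution (normal_law 0 (76/729))" by (rule real_distribution_normal_law) simp
  fix t
  have ch: "char (distr (measure_pmf (random_perm n)) borel (Z1 n)) t
      = measure_pmf.expectation (random_perm n) (\<lambda>\<sigma>. iexp (t * Z1 n \<sigma>))" for n
    unfolding char_def by (subst integral_distr) auto
  have "(\<lambda>n. measure_pmf.expectation (random_perm n) (\<lambda>\<sigma>. iexp (t * Z1 n \<sigma>))
      - measure_pmf.expectation (third_config n) (\<lambda>b. iexp (t * Z_iid n b))) \<longlonglongrightarrow> 0"
  proof (rule Lim_null_comparison)
    show "eventually (\<lambda>n. norm (measure_pmf.expectation (random_perm n) (\<lambda>\<sigma>. iexp (t * Z1 n \<sigma>))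
      - measure_pmf.expectation (third_config n) (\<lambda>b. iexp (t * Z_iid n b))) \<le> \<bar>t\<bar> * coupling_error 1 n) sequentially"
      using eventually_ge_at_top[of "6 ^ 16"] by eventually_elim (rule char_coupling)
    show "(\<lambda>n. \<bar>t\<bar> * coupling_error 1 n) \<longlonglongrightarrow> 0"
      by (intro tendsto_mult_right_zero coupling_error_tendsto_0) simp
  qed
  from tendsto_add[OF this char_Z_iid_tendsto[of t]]
  show "(\<lambda>n. char (distr (measure_pmf (random_perm n)) borel (Z1 n)) t) \<longlonglongrightarrow> char (normal_law 0 (76/729)) t"
    unfolding ch by (simp add: char_normal_law)
qed

lemma Z1_moments_conv:
  "(\<lambda>n. measure_pmf.expectation (random_perm n) (\<lambda>\<sigma>. Z1 n \<sigma> ^ r))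
     \<longlonglongrightarrow> (LINT x|normal_law 0 (76/729). x ^ r)"
proof -
  let ?D = "\<lambda>n. distr (measure_pmf (random_perm n)) borel (Z1 n)"
  \<comment> \<open>The bound for the moments of \<open>Z1\<close> with
    \<open>coupling_error\<close> replaced by 1, which exceeds it for large
    \<open>n\<close>.\<close>
  define C :: real where "C = 2 ^ Suc r * (3 * 12 ^ Suc r * fact (Suc r) + 1)"
  have "(\<lambda>n. LINT x|?D n. x ^ r) \<longlonglongrightarrow> (LINT x|normal_law 0 (76/729). x ^ r)"
  proof (rule weak_conv_imp_moments_conv[OF _ _ Z1_weak_conv, where C = C])
    show "real_distribution (?D n)" for n
      by (rule prob_space.real_distribution_distr) (auto intro: prob_space_measure_pmf)
    show "real_distribution (normal_law 0 (76/729))" by (rule real_distribution_normal_law) simp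
    show "integrable (?D n) (\<lambda>x. \<bar>x\<bar> ^ Suc r)" for n
      by (subst integrable_distr_eq) (auto intro: integrable_measure_pmf_finite finite_random_perm)
    show "integrable (normal_law 0 (76/729)) (\<lambda>x. \<bar>x\<bar> ^ Suc r)"
      by (rule integrable_normal_law_power) simp
    have "eventually (\<lambda>n. coupling_error (Suc r) n < 1) sequentially"
      by (rule order_tendstoD(2)[OF coupling_error_tendsto_0]) auto
    then show "eventually (\<lambda>n. (LINT x|?D n. \<bar>x\<bar> ^ Suc r) \<le> C) sequentially"
      using eventually_ge_at_top[of "6 ^ 16"]
    proof eventually_elim
      case (elim n)
      have "(LINT x|?D n. \<bar>x\<bar> ^ Suc r) = measure_pmf.expectation (random_perm n) (\<lambda>\<sigma>. \<bar>Z1 n \<sigma>\<bar> ^ Suc r)"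
        by (subst integral_distr) auto
      also have "\<dots> \<le> 2 ^ Suc r * (3 * 12 ^ Suc r * fact (Suc r) + coupling_error (Suc r) n)"
        by (rule Z1_moment_bound[OF elim(2)])
      also have "\<dots> \<le> C" unfolding C_def using elim by (intro mult_left_mono add_left_mono) auto
      finally show ?case .
    qed
  qed
  moreover have "(LINT x|?D n. x ^ r) = measure_pmf.expectation (random_perm n) (\<lambda>\<sigma>. Z1 n \<sigma> ^ r)" for n
    by (subst integral_distr) auto
  ultimately show ?thesis by simp
qed

section \<open>Mean and variance of the maximum\<close>

lemma X1_max_eq_Z1: "n > 0 \<Longrightarrow> X1_max n \<sigma> = 4/27 * real n + sqrt (real n) * Z1 n \<sigma>"
  unfolding Z1_def by (simp add: powr_minus_divide powr_half_sqrt)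

lemma expectation_X1_max:
  assumes "n > 0"
  shows "measure_pmf.expectation (random_perm n) (X1_max n)
     = 4/27 * real n + sqrt (real n) * measure_pmf.expectation (random_perm n) (Z1 n)"
proof -
  note int = integrable_measure_pmf_finite[OF finite_random_perm, where 'b = real]
  have "X1_max n = (\<lambda>\<sigma>. 4/27 * real n + sqrt (real n) * Z1 n \<sigma>)"
    by (rule ext) (rule X1_max_eq_Z1[OF assms])
  then show ?thesis by (simp add: int)
qed

lemma variance_X1_max:
  assumes "n > 0"
  shows "measure_pmf.variance (random_perm n) (X1_max n)
     = real n * (measure_pmf.expectation (random_perm n) (\<lambda>\<sigma>. Z1 n \<sigma> ^ 2)
         - (measure_pmf.expectation (random_perm n) (Z1 n))\<^sup>2)"
proof -
  note int = integrable_measure_pmf_finite[OF finite_random_perm, where 'b = real]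
  define \<mu> where "\<mu> = measure_pmf.expectation (random_perm n) (Z1 n)"
  have "(X1_max n \<sigma> - measure_pmf.expectation (random_perm n) (X1_max n))\<^sup>2
      = real n * (Z1 n \<sigma> ^ 2 - 2 * \<mu> * Z1 n \<sigma> + \<mu>\<^sup>2)" for \<sigma>
  proof -
    have "X1_max n \<sigma> - measure_pmf.expectation (random_perm n) (X1_max n) = sqrt (real n) * (Z1 n \<sigma> - \<mu>)"
      unfolding expectation_X1_max[OF assms] \<mu>_def using X1_max_eq_Z1[OF assms, of \<sigma>]
      by (simp add: algebra_simps)
    then show ?thesis by (simp add: power_mult_distrib power2_diff mult_ac)
  qed
  then have "measure_pmf.variance (random_perm n) (X1_max n)
     = measure_pmf.expectation (random_perm n) (\<lambda>\<sigma>. real n * (Z1 n \<sigma> ^ 2 - 2 * \<mu> * Z1 n \<sigma> + \<mu>\<^sup>2))"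
    by simp
  also have "\<dots> = real n * (measure_pmf.expectation (random_perm n) (\<lambda>\<sigma>. Z1 n \<sigma> ^ 2) - 2 * \<mu> * \<mu> + \<mu>\<^sup>2)"
    by (simp add: int \<mu>_def)
  finally show ?thesis by (simp add: \<mu>_def power2_eq_square)
qed

theorem theorem7p3:
  "weak_conv_m (\<lambda>n. distr (measure_pmf (random_perm n)) borel (Z1 n)) (normal_law 0 (76/729))
   \<and> (\<forall>r::nat. (\<lambda>n. measure_pmf.expectation (random_perm n) (\<lambda>\<sigma>. Z1 n \<sigma> ^ r))
            \<longlonglongrightarrow> (LINT x|normal_law 0 (76/729). x ^ r))
   \<and> (\<lambda>n. measure_pmf.expectation (random_perm n) (X1_max n) - 4/27 * real n)
            \<in> o(\<lambda>n. real n powr (1/2))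
   \<and> (\<lambda>n. measure_pmf.variance (random_perm n) (X1_max n) - 76/729 * real n)
            \<in> o(\<lambda>n. real n)"
proof (intro conjI allI)
  show "weak_conv_m (\<lambda>n. distr (measure_pmf (random_perm n)) borel (Z1 n)) (normal_law 0 (76/729))"
    by (rule Z1_weak_conv)
  show "(\<lambda>n. measure_pmf.expectation (random_perm n) (\<lambda>\<sigma>. Z1 n \<sigma> ^ r))
            \<longlonglongrightarrow> (LINT x|normal_law 0 (76/729). x ^ r)" for r
    by (rule Z1_moments_conv)
  have m1: "(\<lambda>n. measure_pmf.expectation (random_perm n) (Z1 n)) \<longlonglongrightarrow> 0"
    using Z1_moments_conv[of 1] normal_law_moments(1)[of "76/729"] by simp
  have m2: "(\<lambda>n. measure_pmf.expectation (random_perm n) (\<lambda>\<sigma>. Z1 n \<sigma> ^ 2)) \<longlonglongrightarrow> 76/729"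
    using Z1_moments_conv[of 2] normal_law_moments(2)[of "76/729"] by simp
  have pos: "eventually (\<lambda>n. n > (0::nat)) sequentially" by (rule eventually_gt_at_top)
  show "(\<lambda>n. measure_pmf.expectation (random_perm n) (X1_max n) - 4/27 * real n)
            \<in> o(\<lambda>n. real n powr (1/2))"
  proof (rule smalloI_tendsto)
    have "eventually (\<lambda>n. measure_pmf.expectation (random_perm n) (Z1 n)
        = (measure_pmf.expectation (random_perm n) (X1_max n) - 4/27 * real n) / real n powr (1/2)) sequentially"
      using pos by eventually_elim (simp add: expectation_X1_max powr_half_sqrt)
    then show "(\<lambda>n. (measure_pmf.expectation (random_perm n) (X1_max n) - 4/27 * real n) / real n powr (1/2)) \<longlonglongrightarrow> 0"
      by (rule Lim_transform_eventually[OF m1])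
    show "eventually (\<lambda>n. real n powr (1/2) \<noteq> 0) sequentially" using pos by eventually_elim simp
  qed
  show "(\<lambda>n. measure_pmf.variance (random_perm n) (X1_max n) - 76/729 * real n) \<in> o(\<lambda>n. real n)"
  proof (rule smalloI_tendsto)
    have lim: "(\<lambda>n. measure_pmf.expectation (random_perm n) (\<lambda>\<sigma>. Z1 n \<sigma> ^ 2)
        - (measure_pmf.expectation (random_perm n) (Z1 n))\<^sup>2 - 76/729) \<longlonglongrightarrow> 0"
      using tendsto_diff[OF tendsto_diff[OF m2 tendsto_power[OF m1, of 2]] tendsto_const[of "76/729"]] by simp
    have "eventually (\<lambda>n. measure_pmf.expectation (random_perm n) (\<lambda>\<sigma>. Z1 n \<sigma> ^ 2)
        - (measure_pmf.expectation (random_perm n) (Z1 n))\<^sup>2 - 76/729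
        = (measure_pmf.variance (random_perm n) (X1_max n) - 76/729 * real n) / real n) sequentially"
      using pos by eventually_elim (simp only: variance_X1_max, simp add: field_simps)
    then show "(\<lambda>n. (measure_pmf.variance (random_perm n) (X1_max n) - 76/729 * real n) / real n) \<longlonglongrightarrow> 0"
      by (rule Lim_transform_eventually[OF lim])
    show "eventually (\<lambda>n. real n \<noteq> 0) sequentially" using pos by eventually_elim simp
  qed
qed

end
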